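(* Let $\mathcal{F}$ be an algebraic foliation on $\mathbb{C}^2$. There exists a birational map $\phi$ from $\mathbb{C}^2$ into itself such that the foliation $\phi^{-1}\mathcal{F}$ on $\mathbb{C}^2$ has no singular point.
   Context: An algebraic foliation $\mathcal{F}$ (of codimension one, possibly singular) on $\mathbb{C}^2$ is the foliation defined by a polynomial $1$-form $\omega=E\,\mathrm{d}u+F\,\mathrm{d}v\neq 0$, where $E,F\in\mathbb{C}[u,v]$ have no nonconstant common factor; $\omega$ is unique up to a nonzero constant factor. The singular points of $\mathcal{F}$ are the points of $\mathbb{C}^2$ where $E=F=0$. A birational map of $\mathbb{C}^2$ into itself is a (not necessarily everywhere defined) map given by two rational functions and admitting a rational inverse; equivalently, it is a birational self map of $\mathbb{P}^2_{\mathbb{C}}$, read in the affine chart $\mathbb{C}^2$. For such a map $\phi$, $\phi^{-1}\mathcal{F}$ denotes the pulled-back foliation on $\mathbb{C}^2$, namely the algebraic foliation defined by the polynomial $1$-form without nonconstant common factor in its coefficients that is obtained from the rational $1$-form $\phi^*\omega$ by multiplying by a suitable nonzero rational function (clearing denominators and dividing out common factors). *)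

theory Defs
  imports Complex_Main "HOL-Computational_Algebra.Computational_Algebra"
    "HOL-Computational_Algebra.Field_as_Ring"
begin

section \<open>Polynomials and rational functions in two variables\<close>

text \<open>
  The ring $\mathbb{C}[u,v]$ is represented as $\mathbb{C}[u][v]$: the variable \<open>u\<close> belongs to
  the inner polynomial ring and \<open>v\<close> is the outer variable. The units of this ring are the nonzero
  constants, so \<^const>\<open>coprime\<close> means that there is no nonconstant common factor (and that not both
  polynomials are zero).
\<close>

type_synonym bipoly = "complex poly poly"
type_synonym ratfun = "bipoly fract"

definition const_poly :: "complex \<Rightarrow> bipoly" where
  "const_poly c = [:[:c:]:]"

definition eval_at :: "bipoly \<Rightarrow> complex \<times> complex \<Rightarrow> complex" where
  "eval_at P p = poly (poly P [:snd p:]) (fst p)"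

definition coord_u :: ratfun where
  "coord_u = to_fract [:[:0, 1:]:]"

definition coord_v :: ratfun where
  "coord_v = to_fract [:0, 1:]"

definition poly_du :: "bipoly \<Rightarrow> bipoly" where
  "poly_du P = map_poly pderiv P"

definition poly_dv :: "bipoly \<Rightarrow> bipoly" where
  "poly_dv P = pderiv P"

definition quotient_rule :: "(bipoly \<Rightarrow> bipoly) \<Rightarrow> ratfun \<Rightarrow> ratfun" where
  "quotient_rule D f = (let (P, Q) = quot_of_fract f in Fract (D P * Q - P * D Q) (Q * Q))"

definition rat_du :: "ratfun \<Rightarrow> ratfun" where
  "rat_du = quotient_rule poly_du"

definition rat_dv :: "ratfun \<Rightarrow> ratfun" where
  "rat_dv = quotient_rule poly_dv"

section \<open>Birational maps\<close>

type_synonym ratmap = "ratfun \<times> ratfun"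

definition subst_poly :: "ratmap \<Rightarrow> bipoly \<Rightarrow> ratfun" where
  "subst_poly \<phi> P =
     poly (map_poly (\<lambda>c. poly (map_poly (\<lambda>a. to_fract (const_poly a)) c) (fst \<phi>)) P) (snd \<phi>)"

definition dominant :: "ratmap \<Rightarrow> bool" where
  "dominant \<phi> \<longleftrightarrow> (\<forall>P. P \<noteq> 0 \<longrightarrow> subst_poly \<phi> P \<noteq> 0)"

text \<open>
  The composite of a rational function with a rational map. It is only meaningful if the
  denominator does not vanish identically along the map, which is automatic if the map is dominant.
\<close>
definition subst_rat :: "ratmap \<Rightarrow> ratfun \<Rightarrow> ratfun" where
  "subst_rat \<phi> f = (let (P, Q) = quot_of_fract f in subst_poly \<phi> P / subst_poly \<phi> Q)"

definition ratmap_comp :: "ratmap \<Rightarrow> ratmap \<Rightarrow> ratmap" where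
  "ratmap_comp \<psi> \<phi> = (subst_rat \<phi> (fst \<psi>), subst_rat \<phi> (snd \<psi>))"

definition birational :: "ratmap \<Rightarrow> bool" where
  "birational \<phi> \<longleftrightarrow> dominant \<phi> \<and>
     (\<exists>\<psi>. dominant \<psi> \<and> ratmap_comp \<psi> \<phi> = (coord_u, coord_v) \<and>
          ratmap_comp \<phi> \<psi> = (coord_u, coord_v))"

section \<open>Algebraic foliations\<close>

text \<open>A pair \<open>(E, F)\<close> stands for the 1-form $E\,du + F\,dv$.\<close>

type_synonym poly_form = "bipoly \<times> bipoly"
type_synonym rat_form = "ratfun \<times> ratfun"

text \<open>
  A foliation is represented by the set of all its defining polynomial 1-forms without nonconstant
  common factor, that is, by all nonzero constant multiples of one such form.
\<close>
definition algebraic_foliation :: "poly_form set \<Rightarrow> bool" where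
  "algebraic_foliation \<F> \<longleftrightarrow>
     (\<exists>E F. coprime E F \<and> \<F> = {(const_poly c * E, const_poly c * F) | c. c \<noteq> 0})"

definition singular_points :: "poly_form set \<Rightarrow> (complex \<times> complex) set" where
  "singular_points \<F> = {p. \<exists>(E, F)\<in>\<F>. eval_at E p = 0 \<and> eval_at F p = 0}"

definition foliation_of :: "rat_form \<Rightarrow> poly_form set" where
  "foliation_of \<omega> = {(E, F). coprime E F \<and>
     (\<exists>h. h \<noteq> 0 \<and> to_fract E = h * fst \<omega> \<and> to_fract F = h * snd \<omega>)}"

definition pullback_form :: "ratmap \<Rightarrow> poly_form \<Rightarrow> rat_form" where
  "pullback_form \<phi> \<omega> =
     (let E = subst_poly \<phi> (fst \<omega>); F = subst_poly \<phi> (snd \<omega>)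
      in (E * rat_du (fst \<phi>) + F * rat_du (snd \<phi>), E * rat_dv (fst \<phi>) + F * rat_dv (snd \<phi>)))"

definition pullback_foliation :: "ratmap \<Rightarrow> poly_form set \<Rightarrow> poly_form set" where
  "pullback_foliation \<phi> \<F> = (\<Union>\<omega>\<in>\<F>. foliation_of (pullback_form \<phi> \<omega>))"

section \<open>Basic properties\<close>

lemma const_poly_mult: "const_poly a * const_poly b = const_poly (a * b)"
  by (simp add: const_poly_def)

lemma const_poly_simps [simp]:
  "const_poly 0 = 0" "const_poly 1 = 1" "const_poly c = 0 \<longleftrightarrow> c = 0"
  by (simp_all add: const_poly_def one_pCons)

lemma is_unit_bipoly_iff: "is_unit (P :: bipoly) \<longleftrightarrow> (\<exists>c. c \<noteq> 0 \<and> P = const_poly c)"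
  by (auto simp: is_unit_poly_iff const_poly_def dvd_field_iff)

lemma eval_at_mult: "eval_at (P * Q) p = eval_at P p * eval_at Q p"
  by (simp add: eval_at_def)

lemma eval_at_const_poly: "eval_at (const_poly c) p = c"
  by (simp add: eval_at_def const_poly_def)

lemma subst_poly_generators:
  "subst_poly \<phi> (const_poly c) = to_fract (const_poly c)"
  "subst_poly \<phi> [:[:0, 1:]:] = fst \<phi>"
  "subst_poly \<phi> [:0, 1:] = snd \<phi>"
  by (simp_all add: subst_poly_def map_poly_pCons const_poly_def one_pCons[symmetric])

lemma poly_du_add: "poly_du (P + Q) = poly_du P + poly_du Q"
  by (intro poly_eqI) (simp add: poly_du_def coeff_map_poly pderiv_add)

lemma poly_du_mult: "poly_du (P * Q) = poly_du P * Q + P * poly_du Q"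
proof (rule poly_eqI)
  fix n
  have pd: "pderiv (a * b) = pderiv a * b + a * pderiv b" for a b :: "complex poly"
    by (simp add: pderiv_mult mult_ac)
  show "coeff (poly_du (P * Q)) n = coeff (poly_du P * Q + P * poly_du Q) n"
    by (simp add: poly_du_def coeff_map_poly coeff_mult higher_pderiv_sum[of 1, simplified]
        pd sum.distrib)
qed

lemma poly_dv_mult: "poly_dv (P * Q) = poly_dv P * Q + P * poly_dv Q"
  by (simp add: poly_dv_def pderiv_mult mult_ac)

lemma quotient_rule_Fract:
  assumes D: "\<And>P Q. D (P * Q) = D P * Q + P * D Q" and "Q \<noteq> 0"
  shows "quotient_rule D (Fract P Q) = Fract (D P * Q - P * D Q) (Q * Q)"
proof -
  obtain A B where AB: "quot_of_fract (Fract P Q) = (A, B)" by (cases "quot_of_fract (Fract P Q)")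
  have B: "B \<noteq> 0"
    using AB by (metis snd_conv snd_quot_of_fract_nonzero)
  have "Fract A B = Fract P Q"
    by (metis AB quot_to_fract_quot_of_fract quot_to_fract_def case_prod_conv)
  hence eq: "A * Q = P * B" using B \<open>Q \<noteq> 0\<close> by (simp add: eq_fract)
  hence "D (A * Q) = D (P * B)" by simp
  hence Deq: "D A * Q + A * D Q = D P * B + P * D B" by (simp add: D)
  have "(D A * B - A * D B) * (Q * Q) = (D P * Q - P * D Q) * (B * B)"
    using eq Deq by algebra
  thus ?thesis using AB B \<open>Q \<noteq> 0\<close> by (simp add: quotient_rule_def eq_fract)
qed

lemma rat_du_Fract:
  "Q \<noteq> 0 \<Longrightarrow> rat_du (Fract P Q) = Fract (poly_du P * Q - P * poly_du Q) (Q * Q)"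
  unfolding rat_du_def by (rule quotient_rule_Fract) (simp_all add: poly_du_mult)

lemma rat_dv_Fract:
  "Q \<noteq> 0 \<Longrightarrow> rat_dv (Fract P Q) = Fract (poly_dv P * Q - P * poly_dv Q) (Q * Q)"
  unfolding rat_dv_def by (rule quotient_rule_Fract) (simp_all add: poly_dv_mult)

lemma coprime_proportional_const:
  assumes "coprime E F" "coprime E' F'" and h: "h \<noteq> 0"
    and E: "to_fract E' = h * to_fract E" and F: "to_fract F' = h * to_fract F"
  shows "\<exists>c. c \<noteq> 0 \<and> h = to_fract (const_poly c)"
proof -
  obtain A B where AB: "quot_of_fract h = (A, B)" by (cases "quot_of_fract h")
  have B: "B \<noteq> 0" and cop: "coprime A B"
    using AB by (metis snd_conv snd_quot_of_fract_nonzero,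
                 metis fst_conv snd_conv coprime_quot_of_fract)
  have hAB: "h = to_fract A / to_fract B"
    by (metis AB Fract_conv_to_fract quot_to_fract_quot_of_fract quot_to_fract_def case_prod_conv)
  have "to_fract (B * E') = to_fract (A * E)" "to_fract (B * F') = to_fract (A * F)"
    using E F B hAB by (simp_all add: field_simps)
  hence eqs: "B * E' = A * E" "B * F' = A * F"
    by (simp_all only: to_fract_eq_iff)
  have "B dvd E" "B dvd F"
    using eqs cop by (metis coprime_commute coprime_dvd_mult_right_iff dvd_triv_left)+
  hence uB: "is_unit B" using \<open>coprime E F\<close> by (meson coprime_common_divisor)
  have "A dvd E'" "A dvd F'"
    using eqs cop by (metis coprime_dvd_mult_right_iff dvd_triv_left)+
  hence uA: "is_unit A" using \<open>coprime E' F'\<close> by (meson coprime_common_divisor)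
  obtain a b where ab: "a \<noteq> 0" "A = const_poly a" "b \<noteq> 0" "B = const_poly b"
    using uA uB by (auto simp: is_unit_bipoly_iff)
  have "A = const_poly (a / b) * B"
    using ab by (simp add: const_poly_mult)
  hence "h = to_fract (const_poly (a / b))"
    using hAB B by simp
  thus ?thesis using ab by (intro exI[of _ "a / b"]) simp
qed

lemma foliation_of_nonzero:
  assumes "\<omega> \<noteq> (0, 0)"
  shows "algebraic_foliation (foliation_of \<omega>)"
proof -
  obtain A B where \<omega>: "\<omega> = (A, B)" by (cases \<omega>)
  obtain P Q where A: "A = Fract P Q" and Q: "Q \<noteq> 0" by (cases A)
  obtain R S where B: "B = Fract R S" and S: "S \<noteq> 0" by (cases B)
  define X Y where "X = P * S" and "Y = R * Q"
  have XY: "to_fract X = to_fract (Q * S) * A" "to_fract Y = to_fract (Q * S) * B"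
    using Q S by (simp_all add: X_def Y_def A B Fract_conv_to_fract field_simps)
  have nz: "X \<noteq> 0 \<or> Y \<noteq> 0"
    using assms \<omega> XY Q S by (metis to_fract_eq_0_iff mult_eq_0_iff)
  define g where "g = gcd X Y"
  have g: "g \<noteq> 0" using nz by (simp add: g_def)
  define E F where "E = X div g" and "F = Y div g"
  have EF: "X = E * g" "Y = F * g" by (simp_all add: E_def F_def g_def)
  have cop: "coprime E F"
    using nz unfolding E_def F_def g_def by (metis div_gcd_coprime)
  define k where "k = to_fract (Q * S) / to_fract g"
  have k: "k \<noteq> 0" using g Q S by (simp add: k_def)
  have E: "to_fract E = k * A" and F: "to_fract F = k * B"
    using XY g by (simp_all add: k_def EF field_simps)
  have "foliation_of \<omega> = {(const_poly c * E, const_poly c * F) | c. c \<noteq> 0}" (is "_ = ?R")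
  proof (intro equalityI subsetI)
    fix x assume "x \<in> foliation_of \<omega>"
    then obtain E' F' h where x: "x = (E', F')" "coprime E' F'" "h \<noteq> 0"
      "to_fract E' = h * A" "to_fract F' = h * B"
      by (auto simp: foliation_of_def \<omega>)
    have "\<exists>c. c \<noteq> 0 \<and> h / k = to_fract (const_poly c)"
      by (rule coprime_proportional_const[OF cop x(2)]) (use x k E F in simp_all)
    then obtain c where c: "c \<noteq> 0" "h / k = to_fract (const_poly c)" by blast
    have "to_fract E' = (h / k) * to_fract E" "to_fract F' = (h / k) * to_fract F"
      using x E F k by simp_all
    hence "to_fract E' = to_fract (const_poly c * E)" "to_fract F' = to_fract (const_poly c * F)"
      using c by simp_all
    hence "E' = const_poly c * E" "F' = const_poly c * F" by (simp_all only: to_fract_eq_iff)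
    thus "x \<in> ?R" using x c by blast
  next
    fix x assume "x \<in> ?R"
    then obtain c where c: "c \<noteq> 0" "x = (const_poly c * E, const_poly c * F)" by blast
    have u: "is_unit (const_poly c)" using c by (auto simp: is_unit_bipoly_iff)
    have "coprime (const_poly c * E) (const_poly c * F)"
      using cop u by (simp add: coprime_mult_left_iff coprime_mult_right_iff is_unit_left_imp_coprime is_unit_right_imp_coprime)
    moreover have "to_fract (const_poly c) * k \<noteq> 0" using c k by simp
    ultimately show "x \<in> foliation_of \<omega>"
      using c E F unfolding foliation_of_def \<omega>
      by (auto intro!: exI[of _ "to_fract (const_poly c) * k"])
  qed
  thus ?thesis using cop by (auto simp: algebraic_foliation_def)
qed

end

theory Submission
  imports Defs
begin

text \<open>
  The foliation extends to the projective plane and has finitely many singular points there. Choose a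
  point $p$ of $\mathbb{C}^2$ that is not singular and such that every line through $p$ contains at
  most one singular point. Blow up $p$. The lines through $p$ turn the blown up plane into a bundle
  of projective lines, with the exceptional curve as a section, and the foliation is transverse to
  this curve except over the direction of the leaf through $p$. Remove the fibre of that
  direction, that is, the tangent line $T$ of the leaf. What remains is
  $\mathbb{C}\times\mathbb{P}^1$, where the first coordinate $u$ parametrizes the lines and the
  second is $s=1/t$ for an affine coordinate $t$ on each line vanishing at $p$. The exceptional
  curve $s=\infty$ contains no singular point any more, the others have pairwise different values of
  $u$, and Lagrange interpolation gives a polynomial $q$ whose graph $s=q(u)$ passes through all of
  them. The complement of the graph is isomorphic to $\mathbb{C}^2$ by the coordinates $u$ and
  $v=1/(s-q(u))$, and it contains no singular point.

  The birational map is thus $\phi(u,v)=p+t\cdot A(1,u)$ with $t=v/(1+v\,q(u))$, where $A$ is an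
  invertible matrix whose second column is tangent to the leaf through $p$. It is
  \<open>chart_map\<close> in the locale \<open>chart\<close>, and \<open>birational_chart_map\<close> exhibits
  its inverse. That the pulled back foliation has no singular point is checked with the
  criterion \<open>nonsingular_if_value_nonzero\<close>, in three regions: on $v=0$, the exceptional curve;
  where $v\neq 0$ and the map is regular; and where $1+v\,q(u)=0$, which is mapped to the line
  at infinity. The first two are covered by \<open>pullback_value_finite\<close>; for the third, the form is
  transferred to a chart at infinity by \<open>form_at_infinity\<close> and then evaluated by
  \<open>pullback_value_infinity\<close>. That finitely many points have to be interpolated is
  \<open>finite_common_zeros\<close>, and the choice of $p$ is \<open>point_off_lines\<close>.
\<close>

section \<open>Substitution of rational functions\<close>

text \<open>
  To prove a property of all polynomials in $u$ and $v$ it suffices to treat the generators of the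
  algebra $\mathbb{C}[u,v]$ and its two operations; this hides the nesting $\mathbb{C}[u][v]$.
\<close>

lemma bipoly_induct [case_names const u v add mult]:
  assumes const: "\<And>c. \<Phi> (const_poly c)"
    and u: "\<Phi> [:[:0, 1:]:]" and v: "\<Phi> [:0, 1:]"
    and add: "\<And>P Q. \<Phi> P \<Longrightarrow> \<Phi> Q \<Longrightarrow> \<Phi> (P + Q)"
    and mult: "\<And>P Q. \<Phi> P \<Longrightarrow> \<Phi> Q \<Longrightarrow> \<Phi> (P * Q)"
  shows "\<Phi> P"
proof (induction P)
  case 0
  show ?case using const[of 0] by simp
next
  case (pCons c P)
  have "\<Phi> [:c:]"
  proof (induction c)
    case 0
    show ?case using const[of 0] by simp
  next
    case (pCons a c)
    have "[:pCons a c:] = const_poly a + [:[:0, 1:]:] * [:c:]"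
      by (simp add: const_poly_def)
    thus ?case using add[OF const mult[OF u pCons.IH]] by simp
  qed
  moreover have "pCons c P = [:c:] + [:0, 1:] * P" by simp
  ultimately show ?case using add[OF _ mult[OF v pCons.IH]] by metis
qed

text \<open>
  The two recursion equations of substitution, one for each level of the nesting
  $\mathbb{C}[u][v]$. They turn the homomorphism laws below into inductions over coefficient lists.
\<close>

lemma subst_poly_pCons:
  "subst_poly \<phi> (pCons c P) = subst_poly \<phi> [:c:] + snd \<phi> * subst_poly \<phi> P"
  by (simp add: subst_poly_def map_poly_pCons)

lemma subst_poly_pCons_inner:
  "subst_poly \<phi> [:pCons a c:] = to_fract (const_poly a) + fst \<phi> * subst_poly \<phi> [:c:]"
  by (simp add: subst_poly_def map_poly_pCons)

lemma subst_poly_0 [simp]: "subst_poly \<phi> 0 = 0"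
  by (simp add: subst_poly_def)

lemma subst_poly_add: "subst_poly \<phi> (P + Q) = subst_poly \<phi> P + subst_poly \<phi> Q"
proof -
  have inner: "subst_poly \<phi> [:a + b:] = subst_poly \<phi> [:a:] + subst_poly \<phi> [:b:]" for a b
  proof (induction a b rule: poly_induct2)
    case (pCons x a y b)
    have "to_fract (const_poly (x + y)) = to_fract (const_poly x) + to_fract (const_poly y)"
      by (simp add: const_poly_def flip: to_fract_add)
    thus ?case using pCons by (simp add: subst_poly_pCons_inner algebra_simps)
  qed simp
  show ?thesis
  proof (induction P Q rule: poly_induct2)
    case (pCons a P b Q)
    thus ?case
      by (simp add: subst_poly_pCons[of _ _ P] subst_poly_pCons[of _ _ Q]
          subst_poly_pCons[of _ _ "P + Q"] inner algebra_simps)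
  qed simp
qed

lemma subst_poly_mult: "subst_poly \<phi> (P * Q) = subst_poly \<phi> P * subst_poly \<phi> Q"
proof -
  have const: "subst_poly \<phi> [:smult a c:] = to_fract (const_poly a) * subst_poly \<phi> [:c:]" for a c
    by (induction c)
       (simp_all add: subst_poly_pCons_inner algebra_simps flip: const_poly_mult)
  have inner: "subst_poly \<phi> [:a * b:] = subst_poly \<phi> [:a:] * subst_poly \<phi> [:b:]" for a b
  proof (induction a)
    case (pCons x a)
    have "[:pCons x a * b:] = [:smult x b:] + [:pCons 0 (a * b):]" by simp
    thus ?case using pCons
      by (simp only: subst_poly_add const subst_poly_pCons_inner) (simp add: algebra_simps)
  qed simp
  have smult: "subst_poly \<phi> (smult c Q) = subst_poly \<phi> [:c:] * subst_poly \<phi> Q" for c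
  proof (induction Q)
    case (pCons x Q)
    thus ?case by (simp add: subst_poly_pCons[of _ _ "smult c Q"] subst_poly_pCons[of _ _ Q] inner algebra_simps)
  qed simp
  show ?thesis
  proof (induction P)
    case (pCons c P)
    have "pCons c P * Q = smult c Q + pCons 0 (P * Q)" by simp
    thus ?case using pCons
      by (simp only: subst_poly_add smult subst_poly_pCons[of _ _ P] subst_poly_pCons[of _ _ "P * Q"])
         (simp add: algebra_simps)
  qed simp
qed

lemma subst_poly_power: "subst_poly \<phi> (P ^ n) = subst_poly \<phi> P ^ n"
  using subst_poly_generators(1)[of \<phi> 1] by (induction n) (simp_all add: subst_poly_mult)

lemma subst_poly_id: "subst_poly (coord_u, coord_v) P = to_fract P"
  by (induction P rule: bipoly_induct)
     (simp_all add: subst_poly_generators subst_poly_add subst_poly_mult coord_u_def coord_v_def)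

lemma subst_rat_Fract:
  assumes "dominant \<phi>" "Q \<noteq> 0"
  shows "subst_rat \<phi> (Fract P Q) = subst_poly \<phi> P / subst_poly \<phi> Q"
proof -
  obtain A B where AB: "quot_of_fract (Fract P Q) = (A, B)" by (cases "quot_of_fract (Fract P Q)")
  have B: "B \<noteq> 0" using AB by (metis snd_conv snd_quot_of_fract_nonzero)
  have "Fract A B = Fract P Q"
    by (metis AB quot_to_fract_quot_of_fract quot_to_fract_def case_prod_conv)
  hence "A * Q = P * B" using B assms(2) by (simp add: eq_fract)
  hence "subst_poly \<phi> A * subst_poly \<phi> Q = subst_poly \<phi> P * subst_poly \<phi> B"
    by (metis subst_poly_mult)
  moreover have "subst_poly \<phi> B \<noteq> 0" "subst_poly \<phi> Q \<noteq> 0"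
    using assms B by (simp_all add: dominant_def)
  ultimately show ?thesis using AB by (simp add: subst_rat_def field_simps)
qed

context
  fixes \<phi> :: ratmap
  assumes dom: "dominant \<phi>"
begin

lemma subst_rat_to_fract: "subst_rat \<phi> (to_fract P) = subst_poly \<phi> P"
proof -
  have "subst_poly \<phi> 1 = 1"
    using subst_poly_generators(1)[of \<phi> 1] by simp
  thus ?thesis using subst_rat_Fract[OF dom, of 1 P] by (simp add: to_fract_def)
qed

lemma subst_rat_divide_to_fract:
  "subst_rat \<phi> (to_fract P / to_fract Q) = subst_poly \<phi> P / subst_poly \<phi> Q"
proof (cases "Q = 0")
  case True
  thus ?thesis using subst_rat_to_fract[of 0] by simp
next
  case False
  thus ?thesis using subst_rat_Fract[OF dom False] by (simp add: Fract_conv_to_fract)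
qed

text \<open>
  Substituting a dominant map never makes a denominator vanish, so it is a homomorphism of fields
  $\mathbb{C}(u,v)\to\mathbb{C}(u,v)$.
\<close>

lemma subst_rat_hom:
  shows "subst_rat \<phi> (f + g) = subst_rat \<phi> f + subst_rat \<phi> g"
    and "subst_rat \<phi> (f - g) = subst_rat \<phi> f - subst_rat \<phi> g"
    and "subst_rat \<phi> (f * g) = subst_rat \<phi> f * subst_rat \<phi> g"
    and "subst_rat \<phi> (f / g) = subst_rat \<phi> f / subst_rat \<phi> g"
proof -
  obtain P Q where f: "f = to_fract P / to_fract Q" "Q \<noteq> 0"
    by (metis Fract_cases Fract_conv_to_fract)
  obtain R S where g: "g = to_fract R / to_fract S" "S \<noteq> 0"
    by (metis Fract_cases Fract_conv_to_fract)
  have nz: "subst_poly \<phi> Q \<noteq> 0" "subst_poly \<phi> S \<noteq> 0"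
    using dom f g by (auto simp: dominant_def)
  have fg: "subst_rat \<phi> f = subst_poly \<phi> P / subst_poly \<phi> Q"
    "subst_rat \<phi> g = subst_poly \<phi> R / subst_poly \<phi> S"
    unfolding f(1) g(1) by (simp_all add: subst_rat_divide_to_fract)
  have ops: "f + g = to_fract (P * S + R * Q) / to_fract (Q * S)"
    "f - g = to_fract (P * S - R * Q) / to_fract (Q * S)"
    "f * g = to_fract (P * R) / to_fract (Q * S)"
    "f / g = to_fract (P * S) / to_fract (Q * R)"
    unfolding f(1) g(1) using f(2) g(2) by (simp_all add: field_simps)
  have diff: "subst_poly \<phi> (P * S - R * Q) = subst_poly \<phi> (P * S) - subst_poly \<phi> (R * Q)"
    using subst_poly_add[of \<phi> "P * S - R * Q" "R * Q"] by simp
  show "subst_rat \<phi> (f + g) = subst_rat \<phi> f + subst_rat \<phi> g"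
    "subst_rat \<phi> (f - g) = subst_rat \<phi> f - subst_rat \<phi> g"
    "subst_rat \<phi> (f * g) = subst_rat \<phi> f * subst_rat \<phi> g"
    "subst_rat \<phi> (f / g) = subst_rat \<phi> f / subst_rat \<phi> g"
    using nz unfolding ops fg subst_rat_divide_to_fract diff
    by (simp_all add: subst_poly_mult subst_poly_add field_simps)
qed

text \<open>
  With \<open>\<psi>\<close> an inverse of the dominant map \<open>\<phi>\<close>, this shows that a
  polynomial relation satisfied by the components of \<open>\<psi>\<close> is trivial.
\<close>

lemma subst_rat_subst_poly: "subst_rat \<phi> (subst_poly \<psi> P) = subst_poly (ratmap_comp \<psi> \<phi>) P"
  by (induction P rule: bipoly_induct)
     (simp_all add: subst_poly_generators subst_rat_to_fract subst_poly_add subst_poly_mult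
       subst_rat_hom ratmap_comp_def)

end

definition const_rat :: "complex \<Rightarrow> ratfun" where
  "const_rat c = to_fract (const_poly c)"

lemma const_rat_simps [simp]: "const_rat 0 = 0" "const_rat 1 = 1"
  by (simp_all add: const_rat_def)

lemma const_rat_mult: "const_rat (a * b) = const_rat a * const_rat b"
  by (simp add: const_rat_def flip: const_poly_mult)

lemma const_rat_diff: "const_rat (a - b) = const_rat a - const_rat b"
  by (simp add: const_rat_def const_poly_def flip: to_fract_diff)

text \<open>
  The pair \<open>(fst \<phi>, 0)\<close> serves to write $q(f)$ for a polynomial $q$ in one variable as a
  substitution into a polynomial that does not involve $v$; the second entry is a dummy.
\<close>

lemma subst_rat_coords:
  assumes "dominant \<phi>"
  shows "subst_rat \<phi> coord_u = fst \<phi>" "subst_rat \<phi> coord_v = snd \<phi>"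
    "subst_rat \<phi> (const_rat k) = const_rat k"
    "subst_rat \<phi> 1 = 1" "subst_rat \<phi> 0 = 0"
    "subst_rat \<phi> (to_fract [:q:]) = subst_poly (fst \<phi>, 0) [:q:]"
proof -
  have *: "subst_rat \<phi> (const_rat k) = const_rat k" for k
    using assms by (simp add: const_rat_def subst_rat_to_fract subst_poly_generators)
  show "subst_rat \<phi> (const_rat k) = const_rat k" by (rule *)
  show "subst_rat \<phi> 1 = 1" "subst_rat \<phi> 0 = 0" using *[of 1] *[of 0] by simp_all
  show "subst_rat \<phi> coord_u = fst \<phi>" "subst_rat \<phi> coord_v = snd \<phi>"
    using assms by (simp_all add: coord_u_def coord_v_def subst_rat_to_fract subst_poly_generators)
  show "subst_rat \<phi> (to_fract [:q:]) = subst_poly (fst \<phi>, 0) [:q:]"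
    using assms by (simp add: subst_rat_to_fract subst_poly_def map_poly_pCons)
qed

section \<open>Partial derivatives of rational functions\<close>

text \<open>
  The partial derivatives of rational functions satisfy the Leibniz rule. Together with
  \<open>derivation_divide\<close> this is all that is needed of the chain rule.
\<close>

lemma quotient_rule_mult:
  assumes D: "\<And>P Q. D (P * Q) = D P * Q + P * D Q"
  shows "quotient_rule D (f * g) = quotient_rule D f * g + f * quotient_rule D g"
proof -
  obtain P Q where f: "f = Fract P Q" "Q \<noteq> 0" by (cases f)
  obtain R S where g: "g = Fract R S" "S \<noteq> 0" by (cases g)
  show ?thesis
    using f(2) g(2) unfolding f g mult_fract
    by (simp add: quotient_rule_Fract[of D, OF D])
       (simp add: Fract_conv_to_fract D field_simps)
qed

lemma derivation_divide:
  fixes \<delta> :: "'a :: field \<Rightarrow> 'a"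
  assumes "\<And>f g. \<delta> (f * g) = \<delta> f * g + f * \<delta> g" "g \<noteq> 0"
  shows "\<delta> (f / g) * g\<^sup>2 = \<delta> f * g - f * \<delta> g" "\<delta> (1 / g) * g\<^sup>2 = - \<delta> g"
proof -
  have *: "\<delta> (f / g) * g\<^sup>2 = \<delta> f * g - f * \<delta> g" for f
  proof -
    have "\<delta> f = \<delta> (f / g) * g + f / g * \<delta> g"
      using assms(1)[of "f / g" g] assms(2) by simp
    hence "\<delta> f * g = \<delta> (f / g) * g\<^sup>2 + (f / g * g) * \<delta> g"
      by (simp only: distrib_left distrib_right power2_eq_square mult_ac)
    thus ?thesis using assms(2) by simp
  qed
  show "\<delta> (f / g) * g\<^sup>2 = \<delta> f * g - f * \<delta> g" by (rule *)
  have "\<delta> 1 + \<delta> 1 = \<delta> 1" using assms(1)[of 1 1] by (simp only: mult_1 mult_1_right)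
  hence "\<delta> 1 = 0" by (simp only: add_cancel_left_left)
  thus "\<delta> (1 / g) * g\<^sup>2 = - \<delta> g" using *[of 1] by (simp only: mult_zero_left mult_1 diff_0)
qed

section \<open>Values of rational functions and singular points\<close>

lemma eval_at_0 [simp]: "eval_at 0 p = 0"
  by (simp add: eval_at_def)

lemma eval_at_1 [simp]: "eval_at 1 p = 1"
  by (simp add: eval_at_def)

lemma eval_at_add: "eval_at (P + Q) p = eval_at P p + eval_at Q p"
  by (simp add: eval_at_def)

lemma eval_at_diff: "eval_at (P - Q) p = eval_at P p - eval_at Q p"
  by (simp add: eval_at_def)

text \<open>
  \<open>f\<close> lies in the local ring of the plane at \<open>p\<close> and \<open>c\<close> is its residue. As a
  relation rather than a function, it keeps regularity and value together, and the closure rules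
  below can be chained without side conditions.
\<close>

definition has_value :: "ratfun \<Rightarrow> complex \<times> complex \<Rightarrow> complex \<Rightarrow> bool" where
  "has_value f p c \<longleftrightarrow>
     (\<exists>N D. f = Fract N D \<and> eval_at D p \<noteq> 0 \<and> c = eval_at N p / eval_at D p)"

lemma has_value_Fract: "eval_at D p \<noteq> 0 \<Longrightarrow> has_value (Fract N D) p (eval_at N p / eval_at D p)"
  unfolding has_value_def by blast

lemma has_value_to_fract: "has_value (to_fract P) p (eval_at P p)"
  using has_value_Fract[of 1 p P] by (simp add: to_fract_def)

lemma has_value_add:
  assumes "has_value f p a" "has_value g p b"
  shows "has_value (f + g) p (a + b)"
proof -
  obtain N D M C where f: "f = Fract N D" "eval_at D p \<noteq> 0" "a = eval_at N p / eval_at D p"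
    and g: "g = Fract M C" "eval_at C p \<noteq> 0" "b = eval_at M p / eval_at C p"
    using assms unfolding has_value_def by blast
  have nz: "D \<noteq> 0" "C \<noteq> 0" using f g by auto
  show ?thesis
    unfolding has_value_def
    using f g nz
    by (intro exI[of _ "N * C + M * D"] exI[of _ "D * C"])
       (simp add: eval_at_add eval_at_mult field_simps)
qed

lemma has_value_mult:
  assumes "has_value f p a" "has_value g p b"
  shows "has_value (f * g) p (a * b)"
proof -
  obtain N D M C where f: "f = Fract N D" "eval_at D p \<noteq> 0" "a = eval_at N p / eval_at D p"
    and g: "g = Fract M C" "eval_at C p \<noteq> 0" "b = eval_at M p / eval_at C p"
    using assms unfolding has_value_def by blast
  show ?thesis
    unfolding has_value_def using f g
    by (intro exI[of _ "N * M"] exI[of _ "D * C"]) (simp add: eval_at_mult)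
qed

lemma has_value_0_unique:
  assumes "has_value 0 p a"
  shows "a = 0"
proof -
  obtain N D where ND: "0 = Fract N D" "eval_at D p \<noteq> 0" "a = eval_at N p / eval_at D p"
    using assms unfolding has_value_def by blast
  have "D \<noteq> 0" using ND by auto
  hence "N = 0" using ND(1) by (simp add: Zero_fract_def eq_fract)
  thus ?thesis using ND by simp
qed

lemma has_value_subst_poly:
  assumes "has_value (fst \<phi>) p a" "has_value (snd \<phi>) p b"
  shows "has_value (subst_poly \<phi> P) p (eval_at P (a, b))"
proof (induction P rule: bipoly_induct)
  case (const c)
  show ?case using has_value_to_fract[of "const_poly c" p]
    by (simp add: subst_poly_generators eval_at_const_poly)
next
  case u
  thus ?case using assms by (simp add: subst_poly_generators eval_at_def)
next
  case v
  thus ?case using assms by (simp add: subst_poly_generators eval_at_def)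
next
  case (add P Q)
  thus ?case using has_value_add by (simp add: subst_poly_add eval_at_add)
next
  case (mult P Q)
  thus ?case using has_value_mult by (simp add: subst_poly_mult eval_at_mult)
qed

lemma has_value_rat_du:
  assumes "eval_at D p \<noteq> 0"
  shows "has_value (rat_du (Fract N D)) p
     ((eval_at (poly_du N) p * eval_at D p - eval_at N p * eval_at (poly_du D) p) / (eval_at D p)\<^sup>2)"
proof -
  have "D \<noteq> 0" using assms by auto
  thus ?thesis
    using has_value_Fract[of "D * D" p "poly_du N * D - N * poly_du D"] assms
    by (simp add: rat_du_Fract eval_at_mult eval_at_diff power2_eq_square)
qed

lemma has_value_rat_dv:
  assumes "eval_at D p \<noteq> 0"
  shows "has_value (rat_dv (Fract N D)) p
     ((eval_at (poly_dv N) p * eval_at D p - eval_at N p * eval_at (poly_dv D) p) / (eval_at D p)\<^sup>2)"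
proof -
  have "D \<noteq> 0" using assms by auto
  thus ?thesis
    using has_value_Fract[of "D * D" p "poly_dv N * D - N * poly_dv D"] assms
    by (simp add: rat_dv_Fract eval_at_mult eval_at_diff power2_eq_square)
qed

lemma has_value_pullback_form:
  assumes "has_value (fst \<phi>) p x" "has_value (snd \<phi>) p y"
    and "has_value (rat_du (fst \<phi>)) p x\<^sub>u" "has_value (rat_du (snd \<phi>)) p y\<^sub>u"
    and "has_value (rat_dv (fst \<phi>)) p x\<^sub>v" "has_value (rat_dv (snd \<phi>)) p y\<^sub>v"
  shows "has_value (fst (pullback_form \<phi> (E, F))) p (eval_at E (x, y) * x\<^sub>u + eval_at F (x, y) * y\<^sub>u)"
    and "has_value (snd (pullback_form \<phi> (E, F))) p (eval_at E (x, y) * x\<^sub>v + eval_at F (x, y) * y\<^sub>v)"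
  using assms has_value_subst_poly[OF assms(1,2)]
  by (simp_all add: pullback_form_def Let_def has_value_add has_value_mult)

text \<open>
  A rational 1-form may be multiplied by any rational \<open>k\<close> so as to become regular at the point
  in question. If one of its coefficients is then nonzero at the point, clearing denominators and
  common factors cannot create a zero there: writing the normalized coefficients as
  \<open>A / B\<close> times those of the regular form with coprime \<open>A\<close>, \<open>B\<close>, a common zero
  would force $A$ to vanish at the point, while coprimality makes $A$ a divisor of a denominator that
  does not vanish there.
\<close>

lemma nonsingular_if_value_nonzero:
  assumes EF: "(E, F) \<in> foliation_of \<omega>" and k: "k \<noteq> 0"
    and a: "has_value (k * fst \<omega>) p a" and b: "has_value (k * snd \<omega>) p b"
    and nz: "a \<noteq> 0 \<or> b \<noteq> 0"
  shows "eval_at E p \<noteq> 0 \<or> eval_at F p \<noteq> 0"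
proof (rule ccontr)
  assume zero: "\<not> ?thesis"
  obtain h where cop: "coprime E F" and h: "h \<noteq> 0"
    "to_fract E = h * fst \<omega>" "to_fract F = h * snd \<omega>"
    using EF by (auto simp: foliation_of_def)
  obtain A B where AB: "h / k = Fract A B" "coprime A B" "B \<noteq> 0"
  proof -
    obtain A B where "quot_of_fract (h / k) = (A, B)" by (cases "quot_of_fract (h / k)")
    thus thesis
      using that[of A B] coprime_quot_of_fract[of "h / k"] snd_quot_of_fract_nonzero[of "h / k"]
        quot_to_fract_quot_of_fract[of "h / k"]
      by (simp add: quot_to_fract_def)
  qed
  obtain N C where N: "k * fst \<omega> = Fract N C" "eval_at C p \<noteq> 0" "a = eval_at N p / eval_at C p"
    using a unfolding has_value_def by blast
  obtain M D where M: "k * snd \<omega> = Fract M D" "eval_at D p \<noteq> 0" "b = eval_at M p / eval_at D p"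
    using b unfolding has_value_def by blast
  have CD: "C \<noteq> 0" "D \<noteq> 0" using N M by auto
  have "to_fract E = (h / k) * (k * fst \<omega>)" "to_fract F = (h / k) * (k * snd \<omega>)"
    using h k by simp_all
  hence eqs: "E * (B * C) = A * N" "F * (B * D) = A * M"
    using AB CD by (simp_all add: N M to_fract_def eq_fract)
  have "eval_at A p = 0"
  proof -
    have "eval_at A p * eval_at N p = 0" "eval_at A p * eval_at M p = 0"
      using arg_cong[OF eqs(1), of "\<lambda>P. eval_at P p"] arg_cong[OF eqs(2), of "\<lambda>P. eval_at P p"] zero
      by (simp_all add: eval_at_mult)
    thus ?thesis using nz N M by auto
  qed
  moreover have "A dvd C * D"
  proof -
    have "A dvd B * (E * C)" "A dvd B * (F * D)"
      using eqs by (metis dvd_triv_left mult.left_commute)+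
    hence "A dvd E * C" "A dvd F * D"
      using AB(2) by (simp_all add: coprime_dvd_mult_right_iff)
    hence "A dvd E * (C * D)" "A dvd F * (C * D)"
      by (metis dvd_mult2 mult.assoc, metis dvd_mult2 mult.assoc mult.commute)
    hence "A dvd gcd (E * (C * D)) (F * (C * D))" by simp
    also have "gcd (E * (C * D)) (F * (C * D)) = normalize (C * D)"
      using cop by (simp add: gcd_mult_right gcd.commute[of F E] coprime_iff_gcd_eq_1)
    finally show ?thesis by (simp only: dvd_normalize_iff)
  qed
  hence "eval_at C p * eval_at D p = eval_at A p * eval_at (C * D div A) p"
    by (metis dvd_mult_div_cancel eval_at_mult)
  ultimately show False using N M by simp
qed

lemma foliation_of_scale:
  assumes "k \<noteq> 0"
  shows "foliation_of (k * \<alpha>, k * \<beta>) = foliation_of (\<alpha>, \<beta>)"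
proof -
  have "foliation_of (k * \<alpha>, k * \<beta>) \<subseteq> foliation_of (\<alpha>, \<beta>)" if "k \<noteq> 0" for k \<alpha> \<beta>
    using that unfolding foliation_of_def
    by clarsimp (metis mult.assoc mult_eq_0_iff)
  from this[OF assms] this[of "inverse k" "k * \<alpha>" "k * \<beta>"] assms
  show ?thesis by (intro equalityI) (simp_all flip: mult.assoc)
qed

lemma foliation_of_pullback_const:
  assumes "c \<noteq> 0"
  shows "foliation_of (pullback_form \<phi> (const_poly c * E, const_poly c * F))
    = foliation_of (pullback_form \<phi> (E, F))"
proof -
  define k where "k = to_fract (const_poly c)"
  have k: "k \<noteq> 0" using assms by (simp add: k_def)
  have "pullback_form \<phi> (const_poly c * E, const_poly c * F)
    = (k * fst (pullback_form \<phi> (E, F)), k * snd (pullback_form \<phi> (E, F)))"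
    unfolding pullback_form_def Let_def k_def
    by (simp add: subst_poly_mult subst_poly_generators distrib_left mult.assoc)
  thus ?thesis using foliation_of_scale[OF k] by simp
qed

section \<open>Common zeros, interpolation and general position\<close>

text \<open>
  This is Bezout over the field $\mathbb{C}(u)$, with denominators cleared. Take a nonzero
  element $G$ of the ideal $(E,F)$ of least degree in $v$. Pseudo-division shows that $G$ divides every
  element of the ideal up to a factor from $\mathbb{C}[u]$. If $G$ had positive degree in $v$, a prime
  factor of its primitive part would have positive degree too, hence could not divide that factor and
  would divide both $E$ and $F$.
\<close>

lemma coprime_combination:
  fixes E F :: bipoly
  assumes "coprime E F"
  obtains A B r where "A * E + B * F = [:r:]" "r \<noteq> 0"
proof -
  define I where "I = {A * E + B * F | A B. True}"
  have I_comb: "X * P + Y * Q \<in> I" if "P \<in> I" "Q \<in> I" for X Y P Q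
  proof -
    from that obtain A B A' B' where "P = A * E + B * F" "Q = A' * E + B' * F"
      unfolding I_def by blast
    hence "X * P + Y * Q = (X * A + Y * A') * E + (X * B + Y * B') * F"
      by (simp add: algebra_simps)
    thus ?thesis unfolding I_def by blast
  qed
  have "E = 1 * E + 0 * F" "F = 0 * E + 1 * F" by simp_all
  hence E: "E \<in> I" and F: "F \<in> I" unfolding I_def by blast+
  have "E \<noteq> 0 \<or> F \<noteq> 0" using assms by force
  hence "\<exists>G. G \<in> I \<and> G \<noteq> 0" using E F by blast
  then obtain G where G: "G \<in> I" "G \<noteq> 0"
    and min: "\<And>H. H \<in> I \<Longrightarrow> H \<noteq> 0 \<Longrightarrow> degree G \<le> degree H"
    using exists_least_iff[of "\<lambda>n. \<exists>G. G \<in> I \<and> G \<noteq> 0 \<and> degree G = n"]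
    by (metis (no_types, lifting) linorder_not_less)
  have "degree G = 0"
  proof (rule ccontr)
    assume deg: "degree G \<noteq> 0"
    \<comment> \<open>The constants of the outer polynomial ring are the elements of $\mathbb{C}[u]$.\<close>
    have multiple: "\<exists>c. c \<noteq> 0 \<and> G dvd [:c:] * H" if H: "H \<in> I" for H
    proof -
      obtain q r where qr: "pseudo_divmod H G = (q, r)" by (cases "pseudo_divmod H G")
      define c where "c = lead_coeff G ^ (Suc (degree H) - degree G)"
      from pseudo_divmod[OF G(2) qr]
      have eq: "smult c H = G * q + r" and r: "r = 0 \<or> degree r < degree G"
        by (auto simp: c_def)
      have "r = [:c:] * H + (- q) * G" using eq by (simp add: algebra_simps)
      hence "r \<in> I" using I_comb[OF H G(1)] by metis
      hence "r = 0" using r min by (meson linorder_not_less)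
      thus ?thesis using eq G(2) by (intro exI[of _ c]) (simp add: c_def)
    qed
    have "\<not> is_unit (primitive_part G)"
      using deg by (metis degree_primitive_part degree_pCons_0 is_unit_poly_iff)
    then obtain \<pi> where \<pi>: "prime \<pi>" "\<pi> dvd primitive_part G"
      using prime_divisor_exists G(2) by (metis primitive_part_eq_0_iff)
    have deg\<pi>: "degree \<pi> \<noteq> 0"
    proof
      assume "degree \<pi> = 0"
      then obtain c where c: "\<pi> = [:c:]" by (metis degree_eq_zeroE)
      hence "c dvd content (primitive_part G)" using \<pi>(2) by (simp add: const_poly_dvd_iff_dvd_content)
      hence "is_unit c" using G(2) by simp
      hence "is_unit \<pi>" using c by (simp add: is_unit_const_poly_iff)
      thus False using \<pi>(1) not_prime_unit by blast
    qed
    have dvd: "\<pi> dvd H" if H: "H \<in> I" for H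
    proof -
      obtain c where c: "c \<noteq> 0" "G dvd [:c:] * H" using multiple[OF H] by blast
      have pp: "primitive_part G dvd G"
        using dvd_smult[OF dvd_refl, of "primitive_part G" "content G"] by simp
      have "\<pi> dvd [:c:] * H" by (rule dvd_trans[OF dvd_trans[OF \<pi>(2) pp] c(2)])
      hence "\<pi> dvd [:c:] \<or> \<pi> dvd H" using \<pi>(1) prime_dvd_mult_iff by blast
      moreover have "\<not> \<pi> dvd [:c:]" using deg\<pi> c(1) dvd_imp_degree_le[of \<pi> "[:c:]"] by auto
      ultimately show ?thesis by blast
    qed
    have "is_unit \<pi>" using dvd[OF E] dvd[OF F] assms by (meson coprime_common_divisor)
    thus False using \<pi>(1) not_prime_unit by blast
  qed
  then obtain r where r: "G = [:r:]" by (metis degree_eq_zeroE)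
  obtain A B where "A * E + B * F = G" using G(1) unfolding I_def by blast
  thus thesis using that[of A B r] r G(2) by simp
qed

text \<open>
  There are finitely many possible abscissae by \<open>coprime_combination\<close>. Above each of them there
  are finitely many zeros, since otherwise $E$ and $F$ would share the factor $u - x$.
\<close>

lemma finite_common_zeros:
  assumes "coprime E F"
  shows "finite {z. eval_at E z = 0 \<and> eval_at F z = 0}"
proof -
  obtain A B r where r: "A * E + B * F = [:r:]" "r \<noteq> 0"
    using coprime_combination[OF assms] by metis
  define V where "V x = {y. eval_at E (x, y) = 0 \<and> eval_at F (x, y) = 0}" for x
  have fin: "finite (V x)" for x
  proof -
    \<comment> \<open>Restriction to the line $u = x$, as a polynomial in $v$.\<close>
    define \<epsilon> where "\<epsilon> H = poly (map_poly (\<lambda>c. [:poly c x:]) H) [:0, 1:]" for H :: bipoly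
    have \<epsilon>_pCons: "\<epsilon> (pCons c H) = pCons (poly c x) (\<epsilon> H)" for c H
      by (simp add: \<epsilon>_def map_poly_pCons)
    have \<epsilon>: "eval_at H (x, y) = poly (\<epsilon> H) y" for H y
      by (induction H) (simp_all add: \<epsilon>_pCons, simp_all add: eval_at_def \<epsilon>_def)
    have vanish: "[:[:-x, 1:]:] dvd H" if "\<epsilon> H = 0" for H
      using that
    proof (induction H)
      case (pCons c H)
      thus ?case by (auto simp: \<epsilon>_pCons const_poly_dvd_iff coeff_pCons poly_eq_0_iff_dvd split: nat.splits)
    qed simp
    have "\<epsilon> E \<noteq> 0 \<or> \<epsilon> F \<noteq> 0"
    proof (rule ccontr)
      assume "\<not> ?thesis"
      hence "is_unit [:[:-x, 1:]:]" using vanish assms by (meson coprime_common_divisor)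
      thus False by (auto simp: is_unit_const_poly_iff is_unit_poly_iff)
    qed
    hence "finite {y. poly (\<epsilon> E) y = 0} \<or> finite {y. poly (\<epsilon> F) y = 0}"
      using poly_roots_finite by blast
    moreover have "V x = {y. poly (\<epsilon> E) y = 0} \<inter> {y. poly (\<epsilon> F) y = 0}"
      by (auto simp: V_def \<epsilon>)
    ultimately show ?thesis by (metis finite_Int)
  qed
  have "poly r x = 0" if "y \<in> V x" for x y
  proof -
    have "eval_at [:r:] (x, y) = 0"
      using that by (simp add: r(1)[symmetric] eval_at_add eval_at_mult V_def)
    thus ?thesis by (simp add: eval_at_def)
  qed
  hence "{z. eval_at E z = 0 \<and> eval_at F z = 0} \<subseteq> (SIGMA x:{x. poly r x = 0}. V x)"
    by (auto simp: V_def)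
  thus ?thesis
    by (rule finite_subset[OF _ finite_SigmaI[OF poly_roots_finite[OF r(2)] fin]])
qed

lemma polynomial_interpolation:
  fixes W :: "('a :: field \<times> 'a) set"
  assumes "finite W" "inj_on fst W"
  obtains q where "\<And>x y. (x, y) \<in> W \<Longrightarrow> poly q x = y"
proof -
  have "\<exists>q. \<forall>(x, y)\<in>W. poly q x = y"
    using assms
  proof (induction W)
    case (insert z W)
    obtain x y where z: "z = (x, y)" by (cases z)
    obtain q where q: "\<forall>(x, y)\<in>W. poly q x = y"
      using insert.IH insert.prems by (auto simp: inj_on_def)
    \<comment> \<open>It vanishes exactly at the old nodes, so adding a multiple of it repairs the value at the new one.\<close>
    define w where "w = (\<Prod>a\<in>fst ` W. [:-a, 1:])"
    have w0: "poly w a = 0 \<longleftrightarrow> a \<in> fst ` W" for a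
      using insert.hyps by (auto simp: w_def poly_prod)
    have "x \<notin> fst ` W" using insert.prems insert.hyps(2) z by (force simp: inj_on_def)
    hence "poly w x \<noteq> 0" using w0 by blast
    hence "poly (q + smult ((y - poly q x) / poly w x) w) x = y" by simp
    moreover have "poly (q + smult ((y - poly q x) / poly w x) w) a = b" if "(a, b) \<in> W" for a b
      using that q w0[of a] by force
    ultimately show ?case using z by (intro exI[of _ "q + smult ((y - poly q x) / poly w x) w"]) auto
  qed simp
  thus thesis using that by (auto split: prod.splits)
qed

text \<open>
  A finite union of lines (given by a point and a direction each) does not cover the plane. The point
  is sought on the parabola $y = x^2$, which contains no line, so that each given line excludes only
  finitely many $x$.
\<close>

lemma point_off_lines:
  fixes L :: "((complex \<times> complex) \<times> (complex \<times> complex)) set"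
  assumes "finite L" "(0, 0) \<notin> snd ` L"
  obtains x y where
    "\<And>s\<^sub>1 s\<^sub>2 d\<^sub>1 d\<^sub>2. ((s\<^sub>1, s\<^sub>2), (d\<^sub>1, d\<^sub>2)) \<in> L \<Longrightarrow> (x - s\<^sub>1) * d\<^sub>2 \<noteq> (y - s\<^sub>2) * d\<^sub>1"
proof -
  define f where "f = (\<lambda>((s\<^sub>1, s\<^sub>2), (d\<^sub>1, d\<^sub>2)). [:s\<^sub>2 * d\<^sub>1 - s\<^sub>1 * d\<^sub>2, d\<^sub>2, - d\<^sub>1 :: complex:])"
  have "f l \<noteq> 0" if "l \<in> L" for l
  proof -
    obtain s\<^sub>1 s\<^sub>2 d\<^sub>1 d\<^sub>2 where l: "l = ((s\<^sub>1, s\<^sub>2), (d\<^sub>1, d\<^sub>2))" by (metis prod.exhaust)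
    have "(d\<^sub>1, d\<^sub>2) \<noteq> (0, 0)" using assms(2) that by (force simp: l)
    thus ?thesis by (auto simp: f_def l)
  qed
  hence "finite (\<Union>l\<in>L. {x. poly (f l) x = 0})"
    using assms(1) poly_roots_finite by blast
  then obtain x where x: "x \<notin> (\<Union>l\<in>L. {x. poly (f l) x = 0})"
    using ex_new_if_finite infinite_UNIV_char_0 by blast
  show thesis
  proof (rule that[of x "x ^ 2"])
    fix s\<^sub>1 s\<^sub>2 d\<^sub>1 d\<^sub>2 assume "((s\<^sub>1, s\<^sub>2), (d\<^sub>1, d\<^sub>2)) \<in> L"
    hence "poly (f ((s\<^sub>1, s\<^sub>2), (d\<^sub>1, d\<^sub>2))) x \<noteq> 0" using x by blast
    thus "(x - s\<^sub>1) * d\<^sub>2 \<noteq> (x ^ 2 - s\<^sub>2) * d\<^sub>1"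
      by (auto simp: f_def algebra_simps power2_eq_square)
  qed
qed

lemma eval_at_line:
  "\<exists>r. \<forall>t. poly r t = eval_at P (x + t * a, y + t * b)"
proof (induction P rule: bipoly_induct)
  case (const c)
  show ?case by (intro exI[of _ "[:c:]"]) (simp add: eval_at_const_poly)
next
  case u
  show ?case by (intro exI[of _ "[:x, a:]"]) (simp add: eval_at_def)
next
  case v
  show ?case by (intro exI[of _ "[:y, b:]"]) (simp add: eval_at_def)
next
  case (add P Q)
  then obtain r s where "\<forall>t. poly r t = eval_at P (x + t * a, y + t * b)"
    "\<forall>t. poly s t = eval_at Q (x + t * a, y + t * b)" by blast
  thus ?case by (intro exI[of _ "r + s"]) (simp add: eval_at_add)
next
  case (mult P Q)
  then obtain r s where "\<forall>t. poly r t = eval_at P (x + t * a, y + t * b)"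
    "\<forall>t. poly s t = eval_at Q (x + t * a, y + t * b)" by blast
  thus ?case by (intro exI[of _ "r * s"]) (simp add: eval_at_mult)
qed

lemma nonzero_bipoly_value:
  assumes "P \<noteq> 0"
  obtains p where "eval_at P p \<noteq> 0"
proof -
  obtain y where y: "poly P [:y:] \<noteq> 0"
  proof -
    have "finite {c. poly P c = 0}" using assms by (rule poly_roots_finite)
    hence "finite ((\<lambda>y. [:y:]) -` {c. poly P c = 0})"
      by (rule finite_vimageI) (auto simp: inj_def)
    then obtain y where "y \<notin> (\<lambda>y. [:y:]) -` {c. poly P c = 0}"
      using ex_new_if_finite infinite_UNIV_char_0 by blast
    thus thesis using that by simp
  qed
  obtain x where "poly (poly P [:y:]) x \<noteq> 0" using y poly_all_0_iff_0[of "poly P [:y:]"] by auto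
  thus thesis using that[of "(x, y)"] by (simp add: eval_at_def)
qed

section \<open>The foliation near the line at infinity\<close>

text \<open>
  The substitution $(m,s)\mapsto(1/s,\,m/s)$ is the change to the affine chart of the projective plane
  in which the line at infinity is $s=0$. Multiplying by a power of $s$ makes the image of a polynomial
  polynomial again. The identity is stated for every pair \<open>\<rho>\<close> in place of the coordinates
  $(m,s)$, so that it can be combined with a further change of variables.
\<close>

lemma homogenization:
  obtains n H where
    "\<And>\<rho> :: ratmap. snd \<rho> \<noteq> 0 \<Longrightarrow>
       subst_poly (1 / snd \<rho>, fst \<rho> / snd \<rho>) P * snd \<rho> ^ n = subst_poly \<rho> H"
proof -
  have "\<exists>n H. \<forall>\<rho> :: ratmap. snd \<rho> \<noteq> 0 \<longrightarrow>
       subst_poly (1 / snd \<rho>, fst \<rho> / snd \<rho>) P * snd \<rho> ^ n = subst_poly \<rho> H"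
  proof (induction P rule: bipoly_induct)
    case (const c)
    show ?case by (intro exI[of _ 0] exI[of _ "const_poly c"]) (simp add: subst_poly_generators)
  next
    case u
    show ?case using subst_poly_generators(1)[of _ 1]
      by (intro exI[of _ 1] exI[of _ 1]) (simp add: subst_poly_generators)
  next
    case v
    show ?case by (intro exI[of _ 1] exI[of _ "[:[:0, 1:]:]"]) (simp add: subst_poly_generators)
  next
    case (add P Q)
    then obtain n H m G where
      H: "\<And>\<rho> :: ratmap. snd \<rho> \<noteq> 0 \<Longrightarrow>
        subst_poly (1 / snd \<rho>, fst \<rho> / snd \<rho>) P * snd \<rho> ^ n = subst_poly \<rho> H"
      and G: "\<And>\<rho> :: ratmap. snd \<rho> \<noteq> 0 \<Longrightarrow>
        subst_poly (1 / snd \<rho>, fst \<rho> / snd \<rho>) Q * snd \<rho> ^ m = subst_poly \<rho> G" by blast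
    show ?case
      by (intro exI[of _ "n + m"] exI[of _ "H * [:0, 1:] ^ m + G * [:0, 1:] ^ n"])
         (simp add: subst_poly_add subst_poly_mult subst_poly_power subst_poly_generators
           power_add algebra_simps flip: H G)
  next
    case (mult P Q)
    then obtain n H m G where
      H: "\<And>\<rho> :: ratmap. snd \<rho> \<noteq> 0 \<Longrightarrow>
        subst_poly (1 / snd \<rho>, fst \<rho> / snd \<rho>) P * snd \<rho> ^ n = subst_poly \<rho> H"
      and G: "\<And>\<rho> :: ratmap. snd \<rho> \<noteq> 0 \<Longrightarrow>
        subst_poly (1 / snd \<rho>, fst \<rho> / snd \<rho>) Q * snd \<rho> ^ m = subst_poly \<rho> G" by blast
    show ?case
      by (intro exI[of _ "n + m"] exI[of _ "H * G"])
         (simp add: subst_poly_mult power_add algebra_simps flip: H G)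
  qed
  thus thesis using that by blast
qed

text \<open>
  The foliation near the line at infinity: \<open>E\<^sub>0 dm + F\<^sub>0 ds\<close> defines it in the chart
  $x=1/s$, $y=m/s$ and has no common factor. It is obtained from
  $s\,\hat F\,dm - (\hat E + m\hat F)\,ds$, where the hats denote the polynomials of
  \<open>homogenization\<close>, by dividing out the greatest common divisor. The conclusion expresses
  that pulling back $E\,du+F\,dv$ by a map that factors through this chart is the same, up to a
  rational factor, as pulling back the form in the chart; it may be that this factor is $0$.
\<close>

lemma form_at_infinity:
  assumes "coprime E F"
  obtains E\<^sub>0 F\<^sub>0 where "coprime E\<^sub>0 F\<^sub>0"
    "\<And>\<rho> :: ratmap. snd \<rho> \<noteq> 0 \<Longrightarrow> \<exists>k.
       fst (pullback_form (1 / snd \<rho>, fst \<rho> / snd \<rho>) (E, F)) = k * fst (pullback_form \<rho> (E\<^sub>0, F\<^sub>0)) \<and>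
       snd (pullback_form (1 / snd \<rho>, fst \<rho> / snd \<rho>) (E, F)) = k * snd (pullback_form \<rho> (E\<^sub>0, F\<^sub>0))"
proof -
  obtain n G where G: "\<And>\<rho> :: ratmap. snd \<rho> \<noteq> 0 \<Longrightarrow>
      subst_poly (1 / snd \<rho>, fst \<rho> / snd \<rho>) E * snd \<rho> ^ n = subst_poly \<rho> G"
    using homogenization[of E] by blast
  obtain m H where H: "\<And>\<rho> :: ratmap. snd \<rho> \<noteq> 0 \<Longrightarrow>
      subst_poly (1 / snd \<rho>, fst \<rho> / snd \<rho>) F * snd \<rho> ^ m = subst_poly \<rho> H"
    using homogenization[of F] by blast
  \<comment> \<open>The inverse of the change of chart; applied to it, homogenization gives back the polynomial itself.\<close>
  define \<sigma> :: ratmap where "\<sigma> = (coord_v / coord_u, 1 / coord_u)"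
  have \<sigma>: "snd \<sigma> \<noteq> 0" "(1 / snd \<sigma>, fst \<sigma> / snd \<sigma>) = (coord_u, coord_v)"
    by (simp_all add: \<sigma>_def coord_u_def)
  have E: "E = 0" if "G = 0" using G[OF \<sigma>(1)] \<sigma> that by (simp add: subst_poly_id)
  have F: "F = 0" if "H = 0" using H[OF \<sigma>(1)] \<sigma> that by (simp add: subst_poly_id)
  define s :: bipoly where "s = [:0, 1:]"
  define u :: bipoly where "u = [:[:0, 1:]:]"
  \<comment> \<open>The same power of $s$, with exponent $n + m$, is used to clear both denominators.\<close>
  define G' H' where "G' = G * s ^ m" and "H' = H * s ^ n"
  define A B where "A = s * H'" and "B = - G' - u * H'"
  have "A \<noteq> 0 \<or> B \<noteq> 0"
  proof (rule ccontr)
    assume "\<not> ?thesis"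
    hence "H' = 0" "G' = 0" by (auto simp: A_def B_def s_def)
    hence "E = 0" "F = 0" using E F by (auto simp: G'_def H'_def s_def)
    thus False using assms by auto
  qed
  then obtain g E\<^sub>0 F\<^sub>0 where cop: "coprime E\<^sub>0 F\<^sub>0" and AB: "A = E\<^sub>0 * g" "B = F\<^sub>0 * g"
    using gcd_coprime_exists[of A B] by auto
  have B': "B + G' + u * H' = 0" by (simp add: B_def)
  show thesis
  proof (rule that[OF cop])
    fix \<rho> :: ratmap assume \<rho>: "snd \<rho> \<noteq> 0"
    define x y z where "x = fst \<rho>" and "y = snd \<rho>" and "z = y ^ (n + m)"
    have y: "y \<noteq> 0" and z: "z \<noteq> 0" using \<rho> by (simp_all add: y_def z_def)
    define e f where "e = subst_poly (1 / y, x / y) E" and "f = subst_poly (1 / y, x / y) F"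
    have e: "e * z = subst_poly \<rho> G'"
      using G[OF \<rho>] by (simp add: e_def z_def G'_def x_def y_def s_def subst_poly_mult
          subst_poly_power subst_poly_generators power_add flip: mult.assoc)
    have f: "f * z = subst_poly \<rho> H'"
      using H[OF \<rho>] by (simp add: f_def z_def H'_def x_def y_def s_def subst_poly_mult
          subst_poly_power subst_poly_generators power_add mult_ac)
    have A: "subst_poly \<rho> E\<^sub>0 * subst_poly \<rho> g = y * (f * z)"
      by (simp only: f y_def A_def s_def flip: subst_poly_mult AB subst_poly_generators(3)[of \<rho>])
    have "subst_poly \<rho> B + subst_poly \<rho> G' + subst_poly \<rho> (u * H') = 0"
      using B' by (simp flip: subst_poly_add)
    moreover have "subst_poly \<rho> (u * H') = x * (f * z)"
      by (simp only: f subst_poly_mult u_def subst_poly_generators x_def)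
    moreover have "subst_poly \<rho> B = subst_poly \<rho> F\<^sub>0 * subst_poly \<rho> g"
      by (simp only: AB subst_poly_mult)
    ultimately have B: "subst_poly \<rho> F\<^sub>0 * subst_poly \<rho> g = - e * z - x * (f * z)"
      unfolding e[symmetric] by (simp add: algebra_simps eq_neg_iff_add_eq_0)
    have main: "e * \<delta> (1 / y) + f * \<delta> (x / y)
        = subst_poly \<rho> g / (z * y\<^sup>2) * (subst_poly \<rho> E\<^sub>0 * \<delta> x + subst_poly \<rho> F\<^sub>0 * \<delta> y)"
      if \<delta>: "\<And>f g. \<delta> (f * g) = \<delta> f * g + f * \<delta> g" for \<delta> :: "ratfun \<Rightarrow> ratfun"
    proof -
      have "(e * \<delta> (1 / y) + f * \<delta> (x / y)) * (z * y\<^sup>2)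
          = z * (e * (\<delta> (1 / y) * y\<^sup>2) + f * (\<delta> (x / y) * y\<^sup>2))"
        by (simp add: algebra_simps)
      also have "\<dots> = y * (f * z) * \<delta> x + (- e * z - x * (f * z)) * \<delta> y"
        unfolding derivation_divide(1)[of \<delta> y x, OF \<delta> y] derivation_divide(2)[of \<delta> y, OF \<delta> y]
        by (simp add: algebra_simps)
      also have "\<dots> = subst_poly \<rho> g * (subst_poly \<rho> E\<^sub>0 * \<delta> x + subst_poly \<rho> F\<^sub>0 * \<delta> y)"
        unfolding A[symmetric] B[symmetric] by (simp add: algebra_simps)
      finally have "(e * \<delta> (1 / y) + f * \<delta> (x / y)) * (z * y\<^sup>2)
          = subst_poly \<rho> g * (subst_poly \<rho> E\<^sub>0 * \<delta> x + subst_poly \<rho> F\<^sub>0 * \<delta> y)" .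
      thus ?thesis using y z by (simp add: nonzero_eq_divide_eq)
    qed
    show "\<exists>k. fst (pullback_form (1 / snd \<rho>, fst \<rho> / snd \<rho>) (E, F)) = k * fst (pullback_form \<rho> (E\<^sub>0, F\<^sub>0)) \<and>
       snd (pullback_form (1 / snd \<rho>, fst \<rho> / snd \<rho>) (E, F)) = k * snd (pullback_form \<rho> (E\<^sub>0, F\<^sub>0))"
      using main[of rat_du, unfolded rat_du_def, OF quotient_rule_mult[of poly_du, OF poly_du_mult]]
        main[of rat_dv, unfolded rat_dv_def, OF quotient_rule_mult[of poly_dv, OF poly_dv_mult]]
      unfolding pullback_form_def Let_def fst_conv snd_conv rat_du_def rat_dv_def e_def f_def x_def y_def
      by blast
  qed
qed

section \<open>The birational map\<close>

text \<open>
  The birational map is $\phi(u,v)=p+t\cdot(a+bu,\;c+du)$ with $t=v/(1+v\,q(u))$. Here $u$ is the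
  coordinate on the pencil of lines through $p=(p_1,p_2)$: the line with parameter $u$ has direction
  $A(1,u)$, where $A$ is the matrix with columns $(a,c)$ and $(b,d)$, and the missing direction $(b,d)$
  corresponds to $u=\infty$. On each line, $t$ is the affine coordinate that vanishes at $p$, and
  $1/t=q(u)+1/v$, so that $v=\infty$ is the graph of $q$ in the coordinates $(u,1/t)$.
\<close>

locale chart =
  fixes p\<^sub>1 p\<^sub>2 a b c d :: complex and q :: "complex poly"
  assumes det: "a * d - b * c = 1"
begin

definition denom :: bipoly where
  "denom = [:1, q:]"

definition numer\<^sub>1 :: bipoly where
  "numer\<^sub>1 = [:[:p\<^sub>1:], smult p\<^sub>1 q + [:a, b:]:]"

definition numer\<^sub>2 :: bipoly where
  "numer\<^sub>2 = [:[:p\<^sub>2:], smult p\<^sub>2 q + [:c, d:]:]"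

definition chart_map :: ratmap where
  "chart_map = (Fract numer\<^sub>1 denom, Fract numer\<^sub>2 denom)"

text \<open>
  On the image of the map, \<open>radial\<close> is $t$ and \<open>transversal\<close> is $tu$: they are the
  coordinates of the point relative to the origin $p$ and the basis given by the columns of $A$.
\<close>

definition radial :: ratfun where
  "radial = const_rat d * (coord_u - const_rat p\<^sub>1) - const_rat b * (coord_v - const_rat p\<^sub>2)"

definition transversal :: ratfun where
  "transversal = const_rat a * (coord_v - const_rat p\<^sub>2) - const_rat c * (coord_u - const_rat p\<^sub>1)"

definition slope :: ratfun where
  "slope = transversal / radial"

definition inverse_map :: ratmap where
  "inverse_map = (slope, radial / (1 - radial * subst_poly (slope, 0) [:q:]))"

lemma denom_nonzero: "denom \<noteq> 0"
  by (simp add: denom_def)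

lemma eval_at_denom: "eval_at denom (x, y) = 1 + y * poly q x"
  by (simp add: denom_def eval_at_def)

lemma eval_at_numer:
  "eval_at numer\<^sub>1 (x, y) = p\<^sub>1 * eval_at denom (x, y) + y * (a + b * x)"
  "eval_at numer\<^sub>2 (x, y) = p\<^sub>2 * eval_at denom (x, y) + y * (c + d * x)"
  by (simp_all add: numer\<^sub>1_def numer\<^sub>2_def denom_def eval_at_def algebra_simps)

lemma has_value_chart_map:
  assumes "1 + y * poly q x \<noteq> 0"
  defines "t \<equiv> y / (1 + y * poly q x)"
  shows "has_value (fst chart_map) (x, y) (p\<^sub>1 + t * (a + b * x))"
    and "has_value (snd chart_map) (x, y) (p\<^sub>2 + t * (c + d * x))"
  using has_value_Fract[of denom "(x, y)" numer\<^sub>1] has_value_Fract[of denom "(x, y)" numer\<^sub>2] assms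
  by (simp_all add: chart_map_def eval_at_numer eval_at_denom field_simps)

lemma inverse_matrix:
  assumes "t\<^sub>1 = d * z\<^sub>1 - b * z\<^sub>2" "t\<^sub>2 = a * z\<^sub>2 - c * z\<^sub>1"
  shows "a * t\<^sub>1 + b * t\<^sub>2 = z\<^sub>1" "c * t\<^sub>1 + d * t\<^sub>2 = z\<^sub>2"
  using det unfolding assms by algebra+

text \<open>
  A polynomial $P\neq 0$ is nonzero at some point $z$ off the line through $p$ with direction $(b,d)$.
  That point lies on a line of the pencil with finite parameter $m$. All but finitely many points of
  this line are in the image of the map, so $P$ is also nonzero at some point of the image.
\<close>

lemma dominant_chart_map: "dominant chart_map"
  unfolding dominant_def
proof (intro allI impI notI)
  fix P assume P: "P \<noteq> 0" and zero: "subst_poly chart_map P = 0"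
  \<comment> \<open>The equation of the line through $p$ with direction $(b,d)$.\<close>
  define X where "X = [:[:b * p\<^sub>2 - d * p\<^sub>1, d:], [:- b:]:]"
  have "X \<noteq> 0" using det by (auto simp: X_def)
  then obtain z\<^sub>1 z\<^sub>2 where z: "eval_at (P * X) (z\<^sub>1, z\<^sub>2) \<noteq> 0"
    using P nonzero_bipoly_value[of "P * X"] by (metis mult_eq_0_iff surj_pair)
  define x y where "x = d * (z\<^sub>1 - p\<^sub>1) - b * (z\<^sub>2 - p\<^sub>2)" and "y = a * (z\<^sub>2 - p\<^sub>2) - c * (z\<^sub>1 - p\<^sub>1)"
  have "eval_at X (z\<^sub>1, z\<^sub>2) = x"
    by (simp add: X_def x_def eval_at_def algebra_simps)
  hence x: "x \<noteq> 0" and Pz: "eval_at P (z\<^sub>1, z\<^sub>2) \<noteq> 0" using z by (auto simp: eval_at_mult)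
  define m where "m = y / x"
  obtain r where r: "\<forall>t. poly r t = eval_at P (p\<^sub>1 + t * (a + b * m), p\<^sub>2 + t * (c + d * m))"
    using eval_at_line by blast
  have "x * (a + b * m) = z\<^sub>1 - p\<^sub>1" "x * (c + d * m) = z\<^sub>2 - p\<^sub>2"
  proof -
    have xm: "x * m = y" using x by (simp add: m_def)
    have "x * (a + b * m) = a * x + b * (x * m)" "x * (c + d * m) = c * x + d * (x * m)"
      by (simp_all add: algebra_simps)
    thus "x * (a + b * m) = z\<^sub>1 - p\<^sub>1" "x * (c + d * m) = z\<^sub>2 - p\<^sub>2"
      unfolding xm inverse_matrix[OF x_def y_def] .
  qed
  hence "poly r x = eval_at P (z\<^sub>1, z\<^sub>2)" unfolding r[rule_format] by simp
  hence "poly r x \<noteq> 0" using Pz by simp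
  \<comment> \<open>The point with $t\,q(m) = 1$ lies on the graph of $q$; it is the only point of the line to avoid.\<close>
  define g where "g = r * [:1, - poly q m:]"
  have "r \<noteq> 0" using \<open>poly r x \<noteq> 0\<close> by auto
  hence "g \<noteq> 0" unfolding g_def mult_eq_0_iff by simp
  then obtain t where "poly g t \<noteq> 0"
    using poly_all_0_iff_0[of g] by blast
  hence t: "poly r t \<noteq> 0" "1 - t * poly q m \<noteq> 0"
    unfolding g_def poly_mult by auto
  define v where "v = t / (1 - t * poly q m)"
  have D: "1 + v * poly q m = 1 / (1 - t * poly q m)"
    using t by (simp add: v_def field_simps)
  have D0: "1 + v * poly q m \<noteq> 0" using t by (simp add: D)
  have "v / (1 + v * poly q m) = t" using t unfolding D by (simp add: v_def)
  hence "has_value (subst_poly chart_map P) (m, v) (poly r t)"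
    using has_value_subst_poly[OF has_value_chart_map[OF D0], of P] by (simp add: r)
  thus False using zero has_value_0_unique t(1) by metis
qed

text \<open>
  The map written as an expression in the field of rational functions, which is the form in which the
  composites with the inverse map can be computed.
\<close>

lemma chart_map_eq:
  defines "t \<equiv> coord_v / (1 + coord_v * to_fract [:q:])"
  shows "fst chart_map = const_rat p\<^sub>1 + t * (const_rat a + coord_u * const_rat b)"
    and "snd chart_map = const_rat p\<^sub>2 + t * (const_rat c + coord_u * const_rat d)"
    and "1 + coord_v * to_fract [:q:] \<noteq> 0"
proof -
  have D: "to_fract denom = 1 + coord_v * to_fract [:q:]"
    unfolding coord_v_def
    by (simp add: denom_def one_pCons flip: to_fract_mult to_fract_add to_fract_1)
  show nz: "1 + coord_v * to_fract [:q:] \<noteq> 0"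
    using denom_nonzero unfolding D[symmetric] by simp
  have "numer\<^sub>1 = const_poly p\<^sub>1 * denom + [:0, 1:] * (const_poly a + [:[:0, 1:]:] * const_poly b)"
    "numer\<^sub>2 = const_poly p\<^sub>2 * denom + [:0, 1:] * (const_poly c + [:[:0, 1:]:] * const_poly d)"
    by (simp_all add: numer\<^sub>1_def numer\<^sub>2_def denom_def const_poly_def)
  hence N: "to_fract numer\<^sub>1 = const_rat p\<^sub>1 * to_fract denom + coord_v * (const_rat a + coord_u * const_rat b)"
    "to_fract numer\<^sub>2 = const_rat p\<^sub>2 * to_fract denom + coord_v * (const_rat c + coord_u * const_rat d)"
    by (simp_all only: coord_u_def coord_v_def const_rat_def to_fract_mult to_fract_add)
  show "fst chart_map = const_rat p\<^sub>1 + t * (const_rat a + coord_u * const_rat b)"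
    "snd chart_map = const_rat p\<^sub>2 + t * (const_rat c + coord_u * const_rat d)"
    using nz unfolding chart_map_def Fract_conv_to_fract N D t_def by (simp_all add: field_simps)
qed

lemma det_rat: "const_rat a * const_rat d - const_rat b * const_rat c = 1"
  using det by (metis const_rat_diff const_rat_mult const_rat_simps(2))

lemma birational_chart_map: "birational chart_map"
proof -
  define u v Q t where "u = coord_u" and "v = coord_v" and "Q = to_fract [:q:]"
    and "t = v / (1 + v * Q)"
  note hom = subst_rat_hom[OF dominant_chart_map] subst_rat_coords[OF dominant_chart_map]
  have D: "1 + v * Q \<noteq> 0" using chart_map_eq(3) by (simp add: v_def Q_def)
  have v: "v \<noteq> 0" by (simp add: v_def coord_v_def)
  have t: "t \<noteq> 0" using D v by (simp add: t_def)
  have m: "fst chart_map = const_rat p\<^sub>1 + t * (const_rat a + u * const_rat b)"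
    "snd chart_map = const_rat p\<^sub>2 + t * (const_rat c + u * const_rat d)"
    using chart_map_eq by (simp_all add: t_def u_def v_def Q_def)
  have "subst_rat chart_map radial = t * (const_rat a * const_rat d - const_rat b * const_rat c)"
    "subst_rat chart_map transversal = t * u * (const_rat a * const_rat d - const_rat b * const_rat c)"
    unfolding radial_def transversal_def hom m by (simp_all add: algebra_simps)
  hence rt: "subst_rat chart_map radial = t" "subst_rat chart_map transversal = t * u"
    by (simp_all add: det_rat)
  hence slope: "subst_rat chart_map slope = u" using t by (simp add: slope_def hom)
  have "subst_rat chart_map (subst_poly (slope, 0) [:q:]) = subst_poly (u, 0) [:q:]"
    using slope by (simp add: subst_rat_subst_poly[OF dominant_chart_map] ratmap_comp_def subst_rat_coords[OF dominant_chart_map])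
  also have "\<dots> = Q"
    using subst_poly_id[of "[:q:]"] by (simp add: u_def Q_def subst_poly_def map_poly_pCons)
  finally have q: "subst_rat chart_map (subst_poly (slope, 0) [:q:]) = Q" .
  have w: "subst_rat chart_map (1 - radial * subst_poly (slope, 0) [:q:]) = 1 / (1 + v * Q)"
    using D by (simp add: hom rt q t_def field_simps)
  have "t / (1 / (1 + v * Q)) = v" using D by (simp add: t_def)
  hence left: "ratmap_comp inverse_map chart_map = (coord_u, coord_v)"
    by (simp add: ratmap_comp_def inverse_map_def slope subst_rat_hom(4)[OF dominant_chart_map] w rt u_def v_def)
  \<comment> \<open>A polynomial relation between the components of the inverse would pull back to one between $u$ and $v$.\<close>
  have dom: "dominant inverse_map"
    unfolding dominant_def
  proof (intro allI impI notI)
    fix P assume P: "P \<noteq> 0" "subst_poly inverse_map P = 0"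
    have "to_fract P = subst_rat chart_map (subst_poly inverse_map P)"
      by (simp add: subst_rat_subst_poly[OF dominant_chart_map] left subst_poly_id)
    thus False using P hom(9) by simp
  qed
  note hom' = subst_rat_hom[OF dom] subst_rat_coords[OF dom]
  define W where "W = subst_poly (slope, 0) [:q:]"
  have W: "1 - radial * W \<noteq> 0"
    using w D hom(9) by (metis W_def divide_eq_0_iff zero_neq_one)
  have r: "radial \<noteq> 0" using rt(1) t hom(9) by metis
  have inv: "fst inverse_map = slope" "snd inverse_map = radial / (1 - radial * W)"
    by (simp_all add: inverse_map_def W_def)
  have radial': "subst_rat inverse_map t = radial"
    using W unfolding t_def v_def Q_def hom' inv W_def[symmetric] by (simp add: field_simps)
  have "radial * (const_rat a + slope * const_rat b)
      = (const_rat a * const_rat d - const_rat b * const_rat c) * (coord_u - const_rat p\<^sub>1)"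
    "radial * (const_rat c + slope * const_rat d)
      = (const_rat a * const_rat d - const_rat b * const_rat c) * (coord_v - const_rat p\<^sub>2)"
    using r unfolding slope_def by (simp_all add: distrib_left) (simp_all add: radial_def transversal_def algebra_simps)
  hence "ratmap_comp chart_map inverse_map = (coord_u, coord_v)"
    by (simp add: ratmap_comp_def m hom' radial' u_def det_rat) (simp add: inverse_map_def)
  thus ?thesis
    unfolding birational_def using dominant_chart_map dom left by blast
qed

section \<open>Pulling back along the birational map\<close>

lemma eval_derivatives:
  "eval_at (poly_du denom) (x, y) = y * poly (pderiv q) x"
  "eval_at (poly_dv denom) (x, y) = poly q x"
  "eval_at (poly_du numer\<^sub>1) (x, y) = y * (p\<^sub>1 * poly (pderiv q) x + b)"
  "eval_at (poly_dv numer\<^sub>1) (x, y) = p\<^sub>1 * poly q x + a + b * x"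
  "eval_at (poly_du numer\<^sub>2) (x, y) = y * (p\<^sub>2 * poly (pderiv q) x + d)"
  "eval_at (poly_dv numer\<^sub>2) (x, y) = p\<^sub>2 * poly q x + c + d * x"
  by (simp_all add: denom_def numer\<^sub>1_def numer\<^sub>2_def poly_du_def poly_dv_def eval_at_def
      map_poly_pCons pderiv_pCons pderiv_add pderiv_smult)

text \<open>
  The pulled back form at a point where the map is regular. With $D=1+v\,q(u)$ and with
  $g$, $h$ the values of the form on the direction of the line and on $(b,d)$, its coefficients are
  $v(hD-vgq')/D^2$ and $g/D^2$. Hence a zero requires $g=0$ and $vh=0$: away from $v=0$ this is a zero
  of the original form, and on $v=0$ the condition $g\neq 0$ says that the leaf through $p$ does not
  have the direction of the line.
\<close>

lemma pullback_value_finite: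
  fixes E F :: bipoly and x y :: complex
  assumes D: "1 + y * poly q x \<noteq> 0"
  defines "t \<equiv> y / (1 + y * poly q x)"
  defines "e \<equiv> eval_at E (p\<^sub>1 + t * (a + b * x), p\<^sub>2 + t * (c + d * x))"
    and "f \<equiv> eval_at F (p\<^sub>1 + t * (a + b * x), p\<^sub>2 + t * (c + d * x))"
  assumes nz: "e * (a + b * x) + f * (c + d * x) \<noteq> 0 \<or> y \<noteq> 0 \<and> (e \<noteq> 0 \<or> f \<noteq> 0)"
  shows "\<exists>r s. has_value (fst (pullback_form chart_map (E, F))) (x, y) r \<and>
    has_value (snd (pullback_form chart_map (E, F))) (x, y) s \<and> (r \<noteq> 0 \<or> s \<noteq> 0)"
proof -
  define D where "D = 1 + y * poly q x"
  define q' where "q' = poly (pderiv q) x"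
  define g h where "g = e * (a + b * x) + f * (c + d * x)" and "h = e * b + f * d"
  have D0: "D \<noteq> 0" using D by (simp add: D_def)
  have eD: "eval_at denom (x, y) = D" by (simp add: eval_at_denom D_def)
  have Fr: "fst chart_map = Fract numer\<^sub>1 denom" "snd chart_map = Fract numer\<^sub>2 denom"
    by (simp_all add: chart_map_def)
  have num: "y * (p * q' + k) * D - (p * D + y * l) * (y * q') = y * (k * D - y * l * q')"
    "(p * poly q x + l) * D - (p * D + y * l) * poly q x = l" for p k l
    by (simp_all add: D_def algebra_simps)
  have du: "has_value (rat_du (fst chart_map)) (x, y) (y * (b * D - y * (a + b * x) * q') / D\<^sup>2)"
    "has_value (rat_du (snd chart_map)) (x, y) (y * (d * D - y * (c + d * x) * q') / D\<^sup>2)"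
    using has_value_rat_du[of denom "(x, y)" numer\<^sub>1] has_value_rat_du[of denom "(x, y)" numer\<^sub>2] D0
    unfolding Fr eval_derivatives eval_at_numer eD q'_def[symmetric] num by simp_all
  have dv: "has_value (rat_dv (fst chart_map)) (x, y) ((a + b * x) / D\<^sup>2)"
    "has_value (rat_dv (snd chart_map)) (x, y) ((c + d * x) / D\<^sup>2)"
    using has_value_rat_dv[of denom "(x, y)" numer\<^sub>1] has_value_rat_dv[of denom "(x, y)" numer\<^sub>2] D0
    unfolding Fr eval_derivatives eval_at_numer eD add.assoc num by simp_all
  note val = has_value_pullback_form[OF has_value_chart_map[OF D] du dv, of E F,
      folded t_def, folded e_def f_def]
  have r: "e * (y * (b * D - y * (a + b * x) * q') / D\<^sup>2) + f * (y * (d * D - y * (c + d * x) * q') / D\<^sup>2)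
      = y * (h * D - y * g * q') / D\<^sup>2"
    by (simp add: g_def h_def algebra_simps flip: add_divide_distrib diff_divide_distrib)
  have s: "e * ((a + b * x) / D\<^sup>2) + f * ((c + d * x) / D\<^sup>2) = g / D\<^sup>2"
    by (simp add: g_def flip: add_divide_distrib)
  have "y * (h * D - y * g * q') / D\<^sup>2 \<noteq> 0 \<or> g / D\<^sup>2 \<noteq> 0"
  proof (cases "g = 0")
    case True
    have "h \<noteq> 0"
    proof
      assume "h = 0"
      have "e = (e * a + f * c) * d - h * c" "f = h * a - (e * a + f * c) * b"
        using det by (auto simp: h_def) algebra+
      moreover have "e * a + f * c = g - h * x" by (simp add: g_def h_def algebra_simps)
      ultimately show False using True nz \<open>h = 0\<close> by (simp add: g_def)
    qed
    moreover have "y \<noteq> 0" using nz True by (auto simp: g_def)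
    ultimately show ?thesis using True D0 by simp
  qed (use D0 in simp)
  thus ?thesis using val unfolding r s by blast
qed

text \<open>
  The points where the denominator $1+v\,q(u)$ vanishes are sent to the line at infinity. In the chart
  $(m,s)=(y/x,1/x)$ the map is \<open>\<rho>\<close>, which is regular at such a point and sends it to
  $s=0$, provided that the line through $p$ is not vertical. It is a local isomorphism there, so the
  pulled back form vanishes only if the form in the chart vanishes at the image.
\<close>

lemma pullback_value_infinity:
  fixes E F :: bipoly and x y :: complex
  assumes D: "1 + y * poly q x = 0" and \<alpha>: "a + b * x \<noteq> 0"
  defines "\<rho> \<equiv> (Fract numer\<^sub>2 numer\<^sub>1, Fract denom numer\<^sub>1)"
  defines "e \<equiv> eval_at E ((c + d * x) / (a + b * x), 0)"
    and "f \<equiv> eval_at F ((c + d * x) / (a + b * x), 0)"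
  assumes nz: "e \<noteq> 0 \<or> f \<noteq> 0"
  shows "\<exists>r s. has_value (fst (pullback_form \<rho> (E, F))) (x, y) r \<and>
    has_value (snd (pullback_form \<rho> (E, F))) (x, y) s \<and> (r \<noteq> 0 \<or> s \<noteq> 0)"
proof -
  define q' Q \<alpha> \<gamma> where "q' = poly (pderiv q) x" and "Q = poly q x"
    and "\<alpha> = a + b * x" and "\<gamma> = c + d * x"
  have yQ: "y * Q = - 1" using D by (simp add: Q_def eq_neg_iff_add_eq_0 add.commute)
  have nz': "\<alpha> \<noteq> 0" "y \<noteq> 0" "Q \<noteq> 0" using \<alpha> yQ by (auto simp: \<alpha>_def)
  have eD: "eval_at denom (x, y) = 0" using D by (simp add: eval_at_denom)
  have N: "eval_at numer\<^sub>1 (x, y) = y * \<alpha>" "eval_at numer\<^sub>2 (x, y) = y * \<gamma>"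
    by (simp_all add: eval_at_numer eD \<alpha>_def \<gamma>_def)
  have N0: "eval_at numer\<^sub>1 (x, y) \<noteq> 0" using nz' by (simp add: N)
  have \<rho>: "fst \<rho> = Fract numer\<^sub>2 numer\<^sub>1" "snd \<rho> = Fract denom numer\<^sub>1"
    by (simp_all add: \<rho>_def)
  have v: "has_value (fst \<rho>) (x, y) (\<gamma> / \<alpha>)" "has_value (snd \<rho>) (x, y) 0"
    using has_value_Fract[OF N0, of numer\<^sub>2] has_value_Fract[OF N0, of denom] nz'
    by (simp_all add: \<rho> N eD)
  note du = has_value_rat_du[OF N0, of numer\<^sub>2, folded \<rho>] has_value_rat_du[OF N0, of denom, folded \<rho>]
  note dv = has_value_rat_dv[OF N0, of numer\<^sub>2, folded \<rho>] has_value_rat_dv[OF N0, of denom, folded \<rho>]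
  have ed: "eval_at (poly_du denom) (x, y) = y * q'"
    "eval_at (poly_dv denom) (x, y) = Q"
    "eval_at (poly_du numer\<^sub>1) (x, y) = y * (p\<^sub>1 * q' + b)"
    "eval_at (poly_dv numer\<^sub>1) (x, y) = p\<^sub>1 * Q + \<alpha>"
    "eval_at (poly_du numer\<^sub>2) (x, y) = y * (p\<^sub>2 * q' + d)"
    "eval_at (poly_dv numer\<^sub>2) (x, y) = p\<^sub>2 * Q + \<gamma>"
    by (simp_all add: eval_derivatives q'_def Q_def \<alpha>_def \<gamma>_def)
  note val = has_value_pullback_form[OF v du dv, of E F, folded \<alpha>_def \<gamma>_def, unfolded N ed eD,
      folded \<alpha>_def \<gamma>_def]
  have ef: "e = eval_at E (\<gamma> / \<alpha>, 0)" "f = eval_at F (\<gamma> / \<alpha>, 0)"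
    by (simp_all add: e_def f_def \<alpha>_def \<gamma>_def)
  note val = val[folded ef]
  \<comment> \<open>Up to nonzero factors the coefficients are $e + q' K$ and $K$.\<close>
  define K where "K = e * (p\<^sub>2 * \<alpha> - p\<^sub>1 * \<gamma>) + f * \<alpha>"
  have det': "d * \<alpha> - b * \<gamma> = 1" using det by (simp add: \<alpha>_def \<gamma>_def algebra_simps)
  have combine: "e * (A / Z) + f * (B / Z) = (e * A + f * B) / Z" for A B Z
    by (simp add: add_divide_distrib)
  have s: "e * (((p\<^sub>2 * Q + \<gamma>) * (y * \<alpha>) - y * \<gamma> * (p\<^sub>1 * Q + \<alpha>)) / (y * \<alpha>)\<^sup>2) +
      f * ((Q * (y * \<alpha>) - 0 * (p\<^sub>1 * Q + \<alpha>)) / (y * \<alpha>)\<^sup>2) = y * Q * K / (y * \<alpha>)\<^sup>2"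
    unfolding combine
    by (rule arg_cong[of _ _ "\<lambda>z. z / (y * \<alpha>)\<^sup>2"]) (simp add: K_def algebra_simps)
  have "e * (((y * (p\<^sub>2 * q' + d)) * (y * \<alpha>) - y * \<gamma> * (y * (p\<^sub>1 * q' + b))) / (y * \<alpha>)\<^sup>2) +
      f * ((y * q' * (y * \<alpha>) - 0 * (y * (p\<^sub>1 * q' + b))) / (y * \<alpha>)\<^sup>2)
      = y\<^sup>2 * (e * (d * \<alpha> - b * \<gamma>) + q' * K) / (y * \<alpha>)\<^sup>2"
    unfolding combine
    by (rule arg_cong[of _ _ "\<lambda>z. z / (y * \<alpha>)\<^sup>2"]) (simp add: K_def algebra_simps power2_eq_square)
  hence r: "e * (((y * (p\<^sub>2 * q' + d)) * (y * \<alpha>) - y * \<gamma> * (y * (p\<^sub>1 * q' + b))) / (y * \<alpha>)\<^sup>2) +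
      f * ((y * q' * (y * \<alpha>) - 0 * (y * (p\<^sub>1 * q' + b))) / (y * \<alpha>)\<^sup>2)
      = y\<^sup>2 * (e + q' * K) / (y * \<alpha>)\<^sup>2"
    by (simp only: det' mult_1_right)
  have "y\<^sup>2 * (e + q' * K) / (y * \<alpha>)\<^sup>2 \<noteq> 0 \<or> y * Q * K / (y * \<alpha>)\<^sup>2 \<noteq> 0"
  proof (cases "K = 0")
    case True
    hence "e \<noteq> 0" using nz nz' by (auto simp: K_def)
    thus ?thesis using True nz' by simp
  qed (use nz' in simp)
  thus ?thesis using val unfolding r s by blast
qed

lemma chart_map_infinity:
  defines "\<rho> \<equiv> (Fract numer\<^sub>2 numer\<^sub>1, Fract denom numer\<^sub>1)"
  assumes "numer\<^sub>1 \<noteq> 0"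
  shows "snd \<rho> \<noteq> 0" "chart_map = (1 / snd \<rho>, fst \<rho> / snd \<rho>)"
  using assms denom_nonzero by (simp_all add: chart_map_def Fract_conv_to_fract)

text \<open>
  The interplay of the conditions. \<open>tangent\<close> places the direction of the leaf through $p$ at
  $u=\infty$. \<open>graph\<close> says that the graph of $q$, which is the curve removed by the map,
  passes through every singular point of the plane that lies on a line of the pencil with finite
  parameter: at an image point $t\neq 0$ one has $1/t=q(u)+1/v\neq q(u)$, so that no such point is
  hit. \<open>graph_infinity\<close> says the same for the points at infinity, where $1/t=0$; it includes
  the vertical direction, which is not covered by the chart $(y/x,1/x)$.
\<close>

lemma pullback_nonsingular:
  assumes infinity: "\<And>\<rho> :: ratmap. snd \<rho> \<noteq> 0 \<Longrightarrow> \<exists>k.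
       fst (pullback_form (1 / snd \<rho>, fst \<rho> / snd \<rho>) (E, F)) = k * fst (pullback_form \<rho> (E\<^sub>0, F\<^sub>0)) \<and>
       snd (pullback_form (1 / snd \<rho>, fst \<rho> / snd \<rho>) (E, F)) = k * snd (pullback_form \<rho> (E\<^sub>0, F\<^sub>0))"
    and tangent: "eval_at E (p\<^sub>1, p\<^sub>2) * a + eval_at F (p\<^sub>1, p\<^sub>2) * c = 1"
      "eval_at E (p\<^sub>1, p\<^sub>2) * b + eval_at F (p\<^sub>1, p\<^sub>2) * d = 0"
    and graph: "\<And>x t. eval_at E (p\<^sub>1 + t * (a + b * x), p\<^sub>2 + t * (c + d * x)) = 0 \<Longrightarrow>
      eval_at F (p\<^sub>1 + t * (a + b * x), p\<^sub>2 + t * (c + d * x)) = 0 \<Longrightarrow> t \<noteq> 0 \<Longrightarrow> t * poly q x = 1"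
    and graph_infinity: "\<And>x. a + b * x = 0 \<or>
      eval_at E\<^sub>0 ((c + d * x) / (a + b * x), 0) = 0 \<and> eval_at F\<^sub>0 ((c + d * x) / (a + b * x), 0) = 0 \<Longrightarrow>
      poly q x = 0"
  defines "\<omega> \<equiv> pullback_form chart_map (E, F)"
  shows "\<omega> \<noteq> (0, 0)" and "singular_points (foliation_of \<omega>) = {}"
proof -
  have axis: "eval_at E (p\<^sub>1, p\<^sub>2) * (a + b * x) + eval_at F (p\<^sub>1, p\<^sub>2) * (c + d * x) = 1" for x
  proof -
    have "eval_at E (p\<^sub>1, p\<^sub>2) * (a + b * x) + eval_at F (p\<^sub>1, p\<^sub>2) * (c + d * x)
        = (eval_at E (p\<^sub>1, p\<^sub>2) * a + eval_at F (p\<^sub>1, p\<^sub>2) * c)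
          + (eval_at E (p\<^sub>1, p\<^sub>2) * b + eval_at F (p\<^sub>1, p\<^sub>2) * d) * x"
      by (simp add: algebra_simps)
    thus ?thesis by (simp add: tangent)
  qed
  show nz: "\<omega> \<noteq> (0, 0)"
  proof
    \<comment> \<open>On the exceptional curve, here at the origin, the coefficient of $dv$ is $1$.\<close>
    assume "\<omega> = (0, 0)"
    moreover obtain r s where "has_value (fst \<omega>) (0, 0) r" "has_value (snd \<omega>) (0, 0) s" "r \<noteq> 0 \<or> s \<noteq> 0"
      using pullback_value_finite[of 0 0 E F] axis[of 0] unfolding \<omega>_def by auto
    ultimately show False using has_value_0_unique by auto
  qed
  have "eval_at E' (x, y) \<noteq> 0 \<or> eval_at F' (x, y) \<noteq> 0" if EF: "(E', F') \<in> foliation_of \<omega>" for E' F' x y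
  proof (cases "1 + y * poly q x = 0")
    case False
    define t where "t = y / (1 + y * poly q x)"
    define e f where "e = eval_at E (p\<^sub>1 + t * (a + b * x), p\<^sub>2 + t * (c + d * x))"
      and "f = eval_at F (p\<^sub>1 + t * (a + b * x), p\<^sub>2 + t * (c + d * x))"
    have "e * (a + b * x) + f * (c + d * x) \<noteq> 0 \<or> y \<noteq> 0 \<and> (e \<noteq> 0 \<or> f \<noteq> 0)"
    proof (cases "y = 0")
      case True
      thus ?thesis using axis[of x] by (simp add: e_def f_def t_def)
    next
      case y: False
      \<comment> \<open>The equation $1/t = q(x) + 1/y$ keeps the image point off the graph of $q$.\<close>
      have "t * poly q x \<noteq> 1" using False by (simp add: t_def field_simps)
      moreover have "t \<noteq> 0" using y False by (simp add: t_def)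
      ultimately show ?thesis using y graph[of t x] by (auto simp: e_def f_def)
    qed
    then obtain r s where "has_value (fst \<omega>) (x, y) r" "has_value (snd \<omega>) (x, y) s" "r \<noteq> 0 \<or> s \<noteq> 0"
      using pullback_value_finite[OF False, of E F] unfolding \<omega>_def e_def f_def t_def by blast
    thus ?thesis using nonsingular_if_value_nonzero[OF EF, of 1 "(x, y)" r s] by simp
  next
    case True
    define \<rho> where "\<rho> = (Fract numer\<^sub>2 numer\<^sub>1, Fract denom numer\<^sub>1)"
    have y: "y \<noteq> 0" and q: "poly q x \<noteq> 0" using True by auto
    have \<alpha>: "a + b * x \<noteq> 0" using graph_infinity[of x] q by blast
    have "eval_at numer\<^sub>1 (x, y) \<noteq> 0"
      using True y \<alpha> by (simp add: eval_at_numer eval_at_denom)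
    hence "numer\<^sub>1 \<noteq> 0" by auto
    note inf = chart_map_infinity[OF this, folded \<rho>_def]
    obtain k where k: "fst \<omega> = k * fst (pullback_form \<rho> (E\<^sub>0, F\<^sub>0))"
      "snd \<omega> = k * snd (pullback_form \<rho> (E\<^sub>0, F\<^sub>0))"
      using infinity[OF inf(1)] unfolding \<omega>_def inf(2)[symmetric] by blast
    \<comment> \<open>If the factor were $0$, the pulled back form would vanish identically.\<close>
    have "k \<noteq> 0" using nz k by (auto simp: prod_eq_iff)
    obtain r s where "has_value (fst (pullback_form \<rho> (E\<^sub>0, F\<^sub>0))) (x, y) r"
      "has_value (snd (pullback_form \<rho> (E\<^sub>0, F\<^sub>0))) (x, y) s" "r \<noteq> 0 \<or> s \<noteq> 0"
      using pullback_value_infinity[OF True \<alpha>, of E\<^sub>0 F\<^sub>0] graph_infinity[of x] q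
      unfolding \<rho>_def by blast
    thus ?thesis
      using nonsingular_if_value_nonzero[OF EF, of "inverse k" "(x, y)" r s] \<open>k \<noteq> 0\<close> k
      by (simp flip: mult.assoc)
  qed
  thus "singular_points (foliation_of \<omega>) = {}"
    by (fastforce simp: singular_points_def)
qed

end

section \<open>Foliations without singular points\<close>

theorem corollary2:
  fixes \<F> :: "poly_form set"
  assumes "algebraic_foliation \<F>"
  shows "\<exists>\<phi> :: ratmap. birational \<phi> \<and> algebraic_foliation (pullback_foliation \<phi> \<F>) \<and>
           singular_points (pullback_foliation \<phi> \<F>) = {}"
proof -
  obtain E F where EF: "coprime E F" and \<F>: "\<F> = {(const_poly c * E, const_poly c * F) | c. c \<noteq> 0}"
    using assms unfolding algebraic_foliation_def by blast
  obtain E\<^sub>0 F\<^sub>0 where EF\<^sub>0: "coprime E\<^sub>0 F\<^sub>0"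
    and infinity: "\<And>\<rho> :: ratmap. snd \<rho> \<noteq> 0 \<Longrightarrow> \<exists>k.
       fst (pullback_form (1 / snd \<rho>, fst \<rho> / snd \<rho>) (E, F)) = k * fst (pullback_form \<rho> (E\<^sub>0, F\<^sub>0)) \<and>
       snd (pullback_form (1 / snd \<rho>, fst \<rho> / snd \<rho>) (E, F)) = k * snd (pullback_form \<rho> (E\<^sub>0, F\<^sub>0))"
    using form_at_infinity[OF EF] by blast
  define S where "S = {z. eval_at E z = 0 \<and> eval_at F z = 0}"
  define M where "M = {m. eval_at E\<^sub>0 (m, 0) = 0 \<and> eval_at F\<^sub>0 (m, 0) = 0}"
  have finS: "finite S" unfolding S_def by (rule finite_common_zeros[OF EF])
  have "M = (\<lambda>m. (m, 0)) -` {z. eval_at E\<^sub>0 z = 0 \<and> eval_at F\<^sub>0 z = 0}"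
    by (auto simp: M_def)
  hence finM: "finite M"
    using finite_vimageI[OF finite_common_zeros[OF EF\<^sub>0], of "\<lambda>m. (m, 0)"] by (simp add: inj_def)
  \<comment> \<open>The lines that $p$ has to avoid: those through a singular point of the plane that are vertical, that
    pass through a singular point at infinity, or that pass through another singular point.\<close>
  define L where "L = (SIGMA s:S. insert (0, 1) (Pair 1 ` M \<union> (\<lambda>z. (fst z - fst s, snd z - snd s)) ` (S - {s})))"
  have finL: "finite L" unfolding L_def using finS finM by auto
  have L0: "(0, 0) \<notin> snd ` L"
    by (auto simp: L_def prod_eq_iff)
  obtain p\<^sub>1 p\<^sub>2 where p: "\<And>s\<^sub>1 s\<^sub>2 d\<^sub>1 d\<^sub>2. ((s\<^sub>1, s\<^sub>2), (d\<^sub>1, d\<^sub>2)) \<in> L \<Longrightarrow>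
      (p\<^sub>1 - s\<^sub>1) * d\<^sub>2 \<noteq> (p\<^sub>2 - s\<^sub>2) * d\<^sub>1"
    using point_off_lines[OF finL L0] by metis
  have p_vertical: "s\<^sub>1 \<noteq> p\<^sub>1" if "(s\<^sub>1, s\<^sub>2) \<in> S" for s\<^sub>1 s\<^sub>2
    using p[of s\<^sub>1 s\<^sub>2 0 1] that by (auto simp: L_def)
  have p_slope: "(p\<^sub>1 - s\<^sub>1) * m \<noteq> p\<^sub>2 - s\<^sub>2" if "(s\<^sub>1, s\<^sub>2) \<in> S" "m \<in> M" for s\<^sub>1 s\<^sub>2 m
    using p[of s\<^sub>1 s\<^sub>2 1 m] that by (auto simp: L_def)
  have p_pair: "(p\<^sub>1 - s\<^sub>1) * (z\<^sub>2 - s\<^sub>2) \<noteq> (p\<^sub>2 - s\<^sub>2) * (z\<^sub>1 - s\<^sub>1)"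
    if "(s\<^sub>1, s\<^sub>2) \<in> S" "(z\<^sub>1, z\<^sub>2) \<in> S" "(s\<^sub>1, s\<^sub>2) \<noteq> (z\<^sub>1, z\<^sub>2)" for s\<^sub>1 s\<^sub>2 z\<^sub>1 z\<^sub>2
    using p[of s\<^sub>1 s\<^sub>2 "z\<^sub>1 - s\<^sub>1" "z\<^sub>2 - s\<^sub>2"] that by (force simp: L_def)
  \<comment> \<open>The vector $(b,d) = (-f,e)$ is tangent to the leaf through $p$; the first column of $A$ is normalized so
    that the form takes the value $1$ on it, which makes the determinant of $A$ equal to $1$.\<close>
  define e f where "e = eval_at E (p\<^sub>1, p\<^sub>2)" and "f = eval_at F (p\<^sub>1, p\<^sub>2)"
  have "(p\<^sub>1, p\<^sub>2) \<notin> S" using p_vertical by blast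
  hence ef: "e \<noteq> 0 \<or> f \<noteq> 0" by (auto simp: S_def e_def f_def)
  obtain a c where ac: "e * a + f * c = 1"
  proof (cases "e = 0")
    case True
    thus thesis using ef that[of 0 "1 / f"] by simp
  next
    case False
    thus thesis using that[of "1 / e" 0] by simp
  qed
  define b d where "b = - f" and "d = e"
  have det: "a * d - b * c = 1" using ac by (simp add: b_def d_def algebra_simps)
  \<comment> \<open>The parameters of the lines that meet the line at infinity in a singular point or are vertical.\<close>
  define B where "B = {x. a + b * x = 0} \<union> (\<Union>m\<in>M. {x. c + d * x = m * (a + b * x)})"
  have "finite {x. a + b * x = 0}"
  proof -
    have "[:a, b:] \<noteq> 0" using det by auto
    from poly_roots_finite[OF this] show ?thesis by (simp add: algebra_simps)
  qed
  moreover have "finite {x. c + d * x = m * (a + b * x)}" for m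
  proof -
    have "[:c - m * a, d - m * b:] \<noteq> 0"
    proof
      assume "[:c - m * a, d - m * b:] = 0"
      hence "c = m * a" "d = m * b" by simp_all
      thus False using det by simp
    qed
    from poly_roots_finite[OF this] show ?thesis by (simp add: algebra_simps)
  qed
  ultimately have finB: "finite B" unfolding B_def using finM by blast
  \<comment> \<open>The points $(u, s)$ with $s = 1/t$ through which the graph of $q$ has to pass; $s = 0$ at infinity.\<close>
  define W where "W = {(x, 1 / t) | x t. t \<noteq> 0 \<and> (p\<^sub>1 + t * (a + b * x), p\<^sub>2 + t * (c + d * x)) \<in> S} \<union> B \<times> {0}"
  have coords: "t = d * (z\<^sub>1 - p\<^sub>1) - b * (z\<^sub>2 - p\<^sub>2)" "t * x = a * (z\<^sub>2 - p\<^sub>2) - c * (z\<^sub>1 - p\<^sub>1)"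
    if "z\<^sub>1 = p\<^sub>1 + t * (a + b * x)" "z\<^sub>2 = p\<^sub>2 + t * (c + d * x)" for t x z\<^sub>1 z\<^sub>2
  proof -
    have "d * (z\<^sub>1 - p\<^sub>1) - b * (z\<^sub>2 - p\<^sub>2) = t * (a * d - b * c)"
      "a * (z\<^sub>2 - p\<^sub>2) - c * (z\<^sub>1 - p\<^sub>1) = t * x * (a * d - b * c)"
      unfolding that by (simp_all add: algebra_simps)
    thus "t = d * (z\<^sub>1 - p\<^sub>1) - b * (z\<^sub>2 - p\<^sub>2)" "t * x = a * (z\<^sub>2 - p\<^sub>2) - c * (z\<^sub>1 - p\<^sub>1)"
      by (simp_all add: det)
  qed
  have finW: "finite W"
  proof -
    define h where "h z = ((a * (snd z - p\<^sub>2) - c * (fst z - p\<^sub>1)) / (d * (fst z - p\<^sub>1) - b * (snd z - p\<^sub>2)),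
      1 / (d * (fst z - p\<^sub>1) - b * (snd z - p\<^sub>2)))" for z
    have "(x, 1 / t) \<in> h ` S" if "t \<noteq> 0" "(p\<^sub>1 + t * (a + b * x), p\<^sub>2 + t * (c + d * x)) \<in> S" for x t
    proof -
      have "h (p\<^sub>1 + t * (a + b * x), p\<^sub>2 + t * (c + d * x)) = (t * x / t, 1 / t)"
        unfolding h_def fst_conv snd_conv coords[OF refl refl, symmetric] ..
      thus ?thesis using that by (metis image_eqI nonzero_mult_div_cancel_left)
    qed
    hence "W \<subseteq> h ` S \<union> B \<times> {0}" unfolding W_def by blast
    thus ?thesis using finS finB by (meson finite.emptyI finite.insertI finite_SigmaI finite_UnI finite_imageI finite_subset)
  qed
  have off_B: "x \<notin> B" if "(p\<^sub>1 + t * (a + b * x), p\<^sub>2 + t * (c + d * x)) \<in> S" for x t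
    using p_vertical[OF that] p_slope[OF that] unfolding B_def by fastforce
  have unique: "t = t'" if "(p\<^sub>1 + t * (a + b * x), p\<^sub>2 + t * (c + d * x)) \<in> S"
    "(p\<^sub>1 + t' * (a + b * x), p\<^sub>2 + t' * (c + d * x)) \<in> S" for x t t'
  proof (rule ccontr)
    assume "t \<noteq> t'"
    moreover have "a + b * x \<noteq> 0" using p_vertical[OF that(1)] by auto
    ultimately have "(p\<^sub>1 + t * (a + b * x), p\<^sub>2 + t * (c + d * x)) \<noteq> (p\<^sub>1 + t' * (a + b * x), p\<^sub>2 + t' * (c + d * x))"
      by simp
    from p_pair[OF that this] show False by (simp add: algebra_simps)
  qed
  have injW: "inj_on fst W"
  proof (rule inj_onI)
    fix w w' assume "w \<in> W" "w' \<in> W" "fst w = fst w'"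
    thus "w = w'" using off_B unique unfolding W_def by fastforce
  qed
  obtain q where q: "\<And>x y. (x, y) \<in> W \<Longrightarrow> poly q x = y"
    using polynomial_interpolation[OF finW injW] by blast
  interpret chart p\<^sub>1 p\<^sub>2 a b c d q by standard (rule det)
  have nonsingular: "pullback_form chart_map (E, F) \<noteq> (0, 0)"
    "singular_points (foliation_of (pullback_form chart_map (E, F))) = {}"
  proof -
    have t: "eval_at E (p\<^sub>1, p\<^sub>2) * a + eval_at F (p\<^sub>1, p\<^sub>2) * c = 1"
      "eval_at E (p\<^sub>1, p\<^sub>2) * b + eval_at F (p\<^sub>1, p\<^sub>2) * d = 0"
      using ac by (simp_all add: b_def d_def e_def f_def)
    have g: "t * poly q x = 1"
      if "eval_at E (p\<^sub>1 + t * (a + b * x), p\<^sub>2 + t * (c + d * x)) = 0"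
        "eval_at F (p\<^sub>1 + t * (a + b * x), p\<^sub>2 + t * (c + d * x)) = 0" "t \<noteq> 0" for x t
    proof -
      have "(x, 1 / t) \<in> W" using that unfolding W_def S_def by blast
      thus ?thesis using q that(3) by simp
    qed
    have g\<^sub>0: "poly q x = 0" if "a + b * x = 0 \<or>
      eval_at E\<^sub>0 ((c + d * x) / (a + b * x), 0) = 0 \<and> eval_at F\<^sub>0 ((c + d * x) / (a + b * x), 0) = 0" for x
    proof -
      have "x \<in> B"
      proof (cases "a + b * x = 0")
        case False
        hence "(c + d * x) / (a + b * x) \<in> M" using that by (simp add: M_def)
        moreover have "c + d * x = (c + d * x) / (a + b * x) * (a + b * x)" using False by simp
        ultimately show ?thesis unfolding B_def by blast
      qed (simp add: B_def)
      thus ?thesis using q[of x 0] by (simp add: W_def)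
    qed
    show "pullback_form chart_map (E, F) \<noteq> (0, 0)"
      by (rule pullback_nonsingular(1)[OF infinity t g g\<^sub>0])
    show "singular_points (foliation_of (pullback_form chart_map (E, F))) = {}"
      by (rule pullback_nonsingular(2)[OF infinity t g g\<^sub>0])
  qed
  have "(E, F) \<in> \<F>" unfolding \<F> by (auto intro!: exI[of _ 1])
  moreover have "foliation_of (pullback_form chart_map \<omega>) = foliation_of (pullback_form chart_map (E, F))"
    if "\<omega> \<in> \<F>" for \<omega>
    using that foliation_of_pullback_const unfolding \<F> by blast
  ultimately have "pullback_foliation chart_map \<F> = foliation_of (pullback_form chart_map (E, F))"
    unfolding pullback_foliation_def by blast
  thus ?thesis
    using birational_chart_map nonsingular foliation_of_nonzero[OF nonsingular(1)]
    by (intro exI[of _ chart_map]) simp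
qed

end
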